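(* Let $n>0$, let $T=[2]^{<\infty}$ be colored by $\Sigma(i)=(i\bmod n)+1$, and let $A$ be a finite subset of $T$. Then for every natural $k>0$ and every map $\chi:[A]_{\mathrm{Em}}\to[k]$ there is $S\in\mathcal{S}_\Sigma(T)$ such that $\chi$ is constant on the set of elements of $[A]_{\mathrm{Em}}$ included in $S$.
   Context: $[k]=\{0,\dots,k-1\}$. $T=[2]^{<\infty}$ is the tree of finite $0$-$1$ sequences ordered by initial segment; $|t|$ is the length of $t$ and level $T(m)$ is the set of sequences of length $m$. The level coloring is $\Sigma(i)=(i\bmod n)+1$, and an element $t$ has color $\Sigma(|t|)$. A subtree $S\subseteq T$ is strong if: (1) it has a smallest element; (2) every level of $S$ is included in a level of $T$; (3) for every $s\in S$ not maximal in $S$ and every immediate successor $t$ of $s$ in $T$ there is exactly one immediate successor of $s$ in $S$ extending $t$. If the $j$-th level of $S$ lies in $T(l_j)$, the induced coloring sequence is $(\Sigma(l_j))_j$; $\mathcal{S}_\Sigma(T)$ is the set of strong subtrees of infinite height with induced coloring sequence $\Sigma$. For $s,t\in T$, $s\wedge t$ is the longest common initial segment, and for $A\subseteq T$, $A^\wedge=\{s\wedge t: s,t\in A\}$. For finite $A,B\subseteq T$, $A\,\mathrm{Em}\,B$ iff there is a bijection $f:A^\wedge\to B^\wedge$ such that for all $s,t\in A^\wedge$: (i) $s\le t\iff f(s)\le f(t)$; (ii) $|s|<|t|\iff|f(s)|<|f(t)|$; (iii) $s\in A\iff f(s)\in B$; (iv) $t(|s|)=f(t)(|f(s)|)$ whenever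 $|s|<|t|$; (v) $f(s)$ has the same color as $s$. $[A]_{\mathrm{Em}}$ is the $\mathrm{Em}$-equivalence class of $A$. *)

theory Defs
  imports Main "HOL-Library.Sublist"
begin

text \<open>The tree T = [2]^{<infinity} of finite 0-1 sequences is modelled as the type
  bool list (False = 0, True = 1), ordered by prefix (initial segment).\<close>

type_synonym node = "bool list"

definition Sigma :: "nat \<Rightarrow> nat \<Rightarrow> nat" where
  "Sigma n i = i mod n + 1"

definition color :: "nat \<Rightarrow> node \<Rightarrow> nat" where
  "color n t = Sigma n (length t)"

definition imm_succ_in :: "node set \<Rightarrow> node \<Rightarrow> node \<Rightarrow> bool" where
  "imm_succ_in S s u \<longleftrightarrow> u \<in> S \<and> strict_prefix s u \<and>
     \<not> (\<exists>v\<in>S. strict_prefix s v \<and> strict_prefix v u)"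

definition level_of :: "node set \<Rightarrow> nat \<Rightarrow> node set" where
  "level_of S j = {s \<in> S. card {u \<in> S. strict_prefix u s} = j}"

definition strong_subtree :: "node set \<Rightarrow> bool" where
  "strong_subtree S \<longleftrightarrow>
     (\<exists>r\<in>S. \<forall>s\<in>S. prefix r s) \<and>
     (\<forall>j. \<exists>l. \<forall>s\<in>level_of S j. length s = l) \<and>
     (\<forall>s\<in>S. (\<exists>t\<in>S. strict_prefix s t) \<longrightarrow>
        (\<forall>b::bool. \<exists>!u. imm_succ_in S s u \<and> prefix (s @ [b]) u))"

definition strong_Sigma :: "nat \<Rightarrow> node set set" where
  "strong_Sigma n = {S. strong_subtree S \<and> (\<forall>j. level_of S j \<noteq> {}) \<and>
     (\<forall>j. \<forall>s\<in>level_of S j. Sigma n (length s) = Sigma n j)}"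

definition meet :: "node \<Rightarrow> node \<Rightarrow> node" where
  "meet s t = longest_common_prefix s t"

definition meet_closure :: "node set \<Rightarrow> node set" where
  "meet_closure A = {meet s t | s t. s \<in> A \<and> t \<in> A}"

definition Em :: "nat \<Rightarrow> node set \<Rightarrow> node set \<Rightarrow> bool" where
  "Em n A B \<longleftrightarrow> (\<exists>f. bij_betw f (meet_closure A) (meet_closure B) \<and>
     (\<forall>s\<in>meet_closure A. \<forall>t\<in>meet_closure A.
        (prefix s t \<longleftrightarrow> prefix (f s) (f t)) \<and>
        (length s < length t \<longleftrightarrow> length (f s) < length (f t)) \<and>
        (s \<in> A \<longleftrightarrow> f s \<in> B) \<and>
        (length s < length t \<longrightarrow> t ! length s = f t ! length (f s)) \<and>
        color n (f s) = color n s))"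

definition Em_class :: "nat \<Rightarrow> node set \<Rightarrow> node set set" where
  "Em_class n A = {B. finite B \<and> Em n A B}"

end

(* Strong subtrees with the right colors are the ranges of embeddings T -> T that preserve levels,
   immediate successors and lengths modulo n. A copy B of A is the image of one fixed finite set
   under such an embedding psi (without the condition modulo n), and only the values of psi below a
   height h and the lengths of these levels modulo n matter. So it suffices to make a finite
   coloring c(Phi o psi) constant. This is done by induction on h: for psi fixed below level h, the
   color depends on the words chosen on the finitely many strands above psi, that is on one word
   over a finite alphabet, and the Carlson-Simpson theorem for left-variable words yields an
   embedding that makes the color independent of this word; a fusion over all levels J of the tree
   treats all psi at the same time. The Carlson-Simpson theorem is obtained from an idempotent
   ultrafilter all of whose letter substitutions lie in one minimal left ideal. *)

theory Submission
  imports Defs "HOL-Library.FuncSet"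
begin

section \<open>Ultrafilters on words\<close>

text \<open>A copy of A may sit on any levels with the right residues, so the embeddings psi need
  only respect levels; the residues enter \<open>milliken_emb\<close> as the function
  \<open>\<rho>\<close>. The maps that reshape the tree, however, must preserve lengths modulo n,
  since the range of their composition has to carry the coloring sequence Sigma. This obstructs a
  direct use of the Carlson-Simpson theorem, whose words have uncontrolled lengths. Hence a letter
  describes n bits on every strand, so that words change lengths by multiples of n, and the
  remaining residue is written as a padding of zeros. Left variables are essential: the substituted
  letter comes first in its block, so the padding followed by the next bit of a branch is an initial
  segment of that block. Infinitely many psi must be handled at once; but when the strands start at
  a given level J, the part of psi below level h takes finitely many forms, and one coloring of
  words can record the colors for all of them and for all residues.\<close>

definition ultra :: "'a set set \<Rightarrow> bool" where
  "ultra U \<longleftrightarrow> (\<forall>A B. A \<inter> B \<in> U \<longleftrightarrow> A \<in> U \<and> B \<in> U) \<and> (\<forall>A. - A \<in> U \<longleftrightarrow> A \<notin> U)"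

lemma ultra_Int: "ultra U \<Longrightarrow> A \<inter> B \<in> U \<longleftrightarrow> A \<in> U \<and> B \<in> U"
  and ultra_Compl: "ultra U \<Longrightarrow> - A \<in> U \<longleftrightarrow> A \<notin> U"
  by (auto simp: ultra_def)

lemma ultra_empty: "ultra U \<Longrightarrow> {} \<notin> U"
  by (metis Compl_empty_eq Int_empty_left ultra_Int ultra_Compl)

lemma ultra_UNIV: "ultra U \<Longrightarrow> UNIV \<in> U"
  by (metis Compl_UNIV_eq ultra_Compl ultra_empty)

lemma ultra_mono: "ultra U \<Longrightarrow> A \<in> U \<Longrightarrow> A \<subseteq> B \<Longrightarrow> B \<in> U"
  by (metis inf.absorb_iff1 ultra_Int)

lemma ultra_Inter:
  assumes "ultra U" "finite X"
  shows "\<Inter>X \<in> U \<longleftrightarrow> X \<subseteq> U"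
  using assms(2) by (induction X rule: finite_induct) (auto simp: ultra_UNIV ultra_Int assms(1))

lemma ultra_subset_eq: "ultra U \<Longrightarrow> ultra V \<Longrightarrow> U \<subseteq> V \<Longrightarrow> U = V"
  by (metis subset_antisym subsetD subsetI ultra_Compl)

text \<open>A family that is maximal among those with the finite intersection property is an
  ultrafilter; Zorn's lemma supplies one.\<close>

lemma ultra_extension:
  assumes fip: "\<And>X. finite X \<Longrightarrow> X \<subseteq> F \<Longrightarrow> \<Inter>X \<noteq> {}"
  shows "\<exists>U. ultra U \<and> F \<subseteq> U"
proof -
  let ?fip = "\<lambda>G. F \<subseteq> G \<and> (\<forall>X. finite X \<longrightarrow> X \<subseteq> G \<longrightarrow> \<Inter>X \<noteq> {})"
  have "\<exists>U\<in>Collect ?fip. \<forall>G\<in>Collect ?fip. U \<subseteq> G \<longrightarrow> G = U"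
  proof (rule subset_Zorn_nonempty)
    show "Collect ?fip \<noteq> {}" using fip by auto
  next
    fix C assume C: "C \<noteq> {}" "subset.chain (Collect ?fip) C"
    have "\<Inter>X \<noteq> {}" if X: "finite X" "X \<subseteq> \<Union>C" for X
    proof -
      obtain G where "G \<in> C" "X \<subseteq> G"
        by (rule finite_subset_Union_chain[OF X C])
      moreover have "C \<subseteq> Collect ?fip" using C(2) by (simp add: subset.chain_def)
      ultimately have "G \<in> Collect ?fip" by (rule_tac subsetD)
      then show ?thesis using X(1) \<open>X \<subseteq> G\<close> by simp
    qed
    moreover have "F \<subseteq> \<Union>C"
    proof -
      obtain G where "G \<in> C" using C(1) by blast
      moreover from this have "F \<subseteq> G" using C(2) by (auto simp: subset.chain_def)
      ultimately show ?thesis by blast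
    qed
    ultimately show "\<Union>C \<in> Collect ?fip" by blast
  qed
  then obtain U where "U \<in> Collect ?fip" and max: "\<forall>G\<in>Collect ?fip. U \<subseteq> G \<longrightarrow> G = U"
    by (rule bexE)
  then have U: "F \<subseteq> U" "\<And>X. finite X \<Longrightarrow> X \<subseteq> U \<Longrightarrow> \<Inter>X \<noteq> {}" by simp_all
  \<comment> \<open>Maximality decides membership: a set that meets all finite intersections from
    \<open>U\<close> can be added without losing the finite intersection property.\<close>
  have char: "A \<in> U \<longleftrightarrow> (\<forall>X. finite X \<longrightarrow> X \<subseteq> U \<longrightarrow> A \<inter> \<Inter>X \<noteq> {})" for A
  proof
    assume "A \<in> U"
    then show "\<forall>X. finite X \<longrightarrow> X \<subseteq> U \<longrightarrow> A \<inter> \<Inter>X \<noteq> {}"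
      using U(2)[of "insert A X" for X] by simp
  next
    assume A: "\<forall>X. finite X \<longrightarrow> X \<subseteq> U \<longrightarrow> A \<inter> \<Inter>X \<noteq> {}"
    have "\<Inter>X \<noteq> {}" if "finite X" "X \<subseteq> insert A U" for X
    proof -
      have "finite (X - {A})" "X - {A} \<subseteq> U" using that by auto
      then have "A \<inter> \<Inter>(X - {A}) \<noteq> {}" using A by simp
      moreover have "A \<inter> \<Inter>(X - {A}) \<subseteq> \<Inter>X" by blast
      ultimately show ?thesis by blast
    qed
    then have "insert A U = U" using U(1) by (intro max[rule_format]) auto
    then show "A \<in> U" by blast
  qed
  have up: "B \<in> U" if "A \<in> U" "A \<subseteq> B" for A B
  proof -
    have "B \<inter> \<Inter>X \<noteq> {}" if "finite X" "X \<subseteq> U" for X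
      using char[of A] \<open>A \<in> U\<close> \<open>A \<subseteq> B\<close> that by blast
    then show ?thesis using char[of B] by blast
  qed
  have "A \<inter> B \<in> U \<longleftrightarrow> A \<in> U \<and> B \<in> U" for A B
  proof (intro iffI conjI)
    assume "A \<in> U \<and> B \<in> U"
    then have "insert A (insert B X) \<subseteq> U" if "X \<subseteq> U" for X using that by blast
    then have "\<Inter>(insert A (insert B X)) \<noteq> {}" if "finite X" "X \<subseteq> U" for X
      using U that by (meson finite.insertI)
    then show "A \<inter> B \<in> U" unfolding char[of "A \<inter> B"] by (simp add: Int_assoc)
  qed (use up in blast)+
  moreover have "- A \<in> U \<longleftrightarrow> A \<notin> U" for A
  proof
    assume "- A \<in> U"
    then have "A \<inter> \<Inter>{- A} \<noteq> {}" if "A \<in> U"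
      using char[of A] that by (metis empty_subsetI finite.emptyI finite.insertI insert_subset)
    then show "A \<notin> U" by auto
  next
    assume "A \<notin> U"
    then obtain X where X: "finite X" "X \<subseteq> U" "A \<inter> \<Inter>X = {}" using char[of A] by auto
    have "- A \<inter> \<Inter>Y \<noteq> {}" if "finite Y" "Y \<subseteq> U" for Y
    proof -
      have "\<Inter>(X \<union> Y) \<noteq> {}" using X that by (intro U(2)) auto
      then show ?thesis using X(3) by auto
    qed
    then show "- A \<in> U" using char[of "- A"] by simp
  qed
  ultimately have "ultra U" unfolding ultra_def by simp
  then show ?thesis using U(1) by blast
qed

section \<open>The compact space of ultrafilters\<close>

definition ultra_closed :: "'a set set set \<Rightarrow> bool" where
  "ultra_closed C \<longleftrightarrow> C \<subseteq> Collect ultra \<and>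
     (\<forall>U. ultra U \<longrightarrow> (\<forall>A\<in>U. \<exists>V\<in>C. A \<in> V) \<longrightarrow> U \<in> C)"

lemma ultra_closedD: "ultra_closed C \<Longrightarrow> U \<in> C \<Longrightarrow> ultra U"
  by (auto simp: ultra_closed_def)

text \<open>\<open>ultra_closed\<close> is closedness in the Stone topology. This is its dual form:
  a set of \<open>U\<close> lying in no member of \<open>C\<close> would have its complement in all
  of them.\<close>

lemma ultra_closed_mem:
  assumes "ultra_closed C" "ultra U" "\<And>A. \<forall>V\<in>C. A \<in> V \<Longrightarrow> A \<in> U"
  shows "U \<in> C"
proof -
  have "\<exists>V\<in>C. A \<in> V" if "A \<in> U" for A
  proof (rule ccontr)
    assume "\<not> (\<exists>V\<in>C. A \<in> V)"
    then have "\<forall>V\<in>C. - A \<in> V" using assms(1) ultra_Compl ultra_closedD by blast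
    then show False using assms that ultra_Compl by blast
  qed
  then show ?thesis using assms unfolding ultra_closed_def by blast
qed

text \<open>Compactness of a closed set. Adding to \<open>F\<close> the sets common to all members
  of \<open>C\<close> forces the extending ultrafilter into \<open>C\<close>.\<close>

lemma ultra_closed_compact:
  assumes C: "ultra_closed C" and F: "\<And>X. finite X \<Longrightarrow> X \<subseteq> F \<Longrightarrow> \<exists>V\<in>C. X \<subseteq> V"
  shows "\<exists>U\<in>C. F \<subseteq> U"
proof -
  let ?G = "F \<union> {A. \<forall>V\<in>C. A \<in> V}"
  have "\<exists>U. ultra U \<and> ?G \<subseteq> U"
  proof (rule ultra_extension)
    fix X assume X: "finite X" "X \<subseteq> ?G"
    then obtain V where V: "V \<in> C" "X \<inter> F \<subseteq> V" using F[of "X \<inter> F"] by auto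
    then have "X \<subseteq> V" using X by blast
    then have "\<Inter>X \<in> V" using V C X ultra_Inter ultra_closedD by blast
    then show "\<Inter>X \<noteq> {}" using V C ultra_empty ultra_closedD by metis
  qed
  then show ?thesis using ultra_closed_mem[OF C] by blast
qed

lemma ultra_closed_Collect: "ultra_closed {U. ultra U \<and> B \<in> U}"
  unfolding ultra_closed_def
  by (auto, metis ultra_Compl)

lemma ultra_closed_all: "ultra_closed (Collect ultra)"
  by (auto simp: ultra_closed_def)

text \<open>Compactness keeps the intersection of a chain nonempty and \<open>P\<close> survives
  intersections, so Zorn's lemma applies downwards. It serves for subsemigroups and for left
  ideals.\<close>

lemma minimal_ultra_closed:
  assumes "ultra_closed C" "C \<noteq> {}" "P C"
    and P: "\<And>\<C>. \<C> \<noteq> {} \<Longrightarrow> (\<And>C. C \<in> \<C> \<Longrightarrow> P C) \<Longrightarrow> P (\<Inter>\<C>)"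
  obtains M where "ultra_closed M" "M \<noteq> {}" "P M"
    "\<And>N. ultra_closed N \<Longrightarrow> N \<noteq> {} \<Longrightarrow> P N \<Longrightarrow> N \<subseteq> M \<Longrightarrow> N = M"
proof -
  let ?Q = "\<lambda>C. ultra_closed C \<and> C \<noteq> {} \<and> P C"
  \<comment> \<open>Complements turn the search for a minimal set into one for a maximal
    set.\<close>
  let ?A = "{C. ?Q (- C)}"
  have "\<exists>M\<in>?A. \<forall>N\<in>?A. M \<subseteq> N \<longrightarrow> N = M"
  proof (rule subset_Zorn_nonempty)
    show "?A \<noteq> {}" using assms by (metis (mono_tags) double_complement empty_iff mem_Collect_eq)
  next
    fix \<D> assume \<D>: "\<D> \<noteq> {}" "subset.chain ?A \<D>"
    define \<C> where "\<C> = uminus ` \<D>"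
    have \<C>: "\<C> \<noteq> {}" "\<And>C. C \<in> \<C> \<Longrightarrow> ?Q C"
      and lin: "\<And>C D. C \<in> \<C> \<Longrightarrow> D \<in> \<C> \<Longrightarrow> C \<subseteq> D \<or> D \<subseteq> C"
      using \<D> unfolding \<C>_def subset.chain_def by auto
    \<comment> \<open>An ultrafilter containing \<open>?F\<close> lies in every member of the chain;
      as the chain is linearly ordered, one member handles any finite part of
      \<open>?F\<close>.\<close>
    let ?F = "{A. \<exists>C\<in>\<C>. \<forall>V\<in>C. A \<in> V}"
    obtain C0 where C0: "C0 \<in> \<C>" using \<C>(1) by blast
    have "\<exists>C\<in>\<C>. \<forall>V\<in>C. X \<subseteq> V" if "finite X" "X \<subseteq> ?F" for X
      using that
    proof (induction X)
      case empty
      then show ?case using C0 by blast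
    next
      case (insert A X)
      then obtain C D where "C \<in> \<C>" "\<forall>V\<in>C. X \<subseteq> V" "D \<in> \<C>" "\<forall>V\<in>D. A \<in> V" by auto
      then show ?case using lin[of C D] by (metis insert_subset subset_iff)
    qed
    then have *: "\<exists>C\<in>\<C>. \<forall>V\<in>C. X \<subseteq> V" if "finite X" "X \<subseteq> ?F" for X
      using that by blast
    have "\<exists>U\<in>Collect ultra. ?F \<subseteq> U"
    proof (rule ultra_closed_compact[OF ultra_closed_all])
      fix X assume "finite X" "X \<subseteq> ?F"
      then obtain C where "C \<in> \<C>" "\<forall>V\<in>C. X \<subseteq> V" using * by blast
      then show "\<exists>V\<in>Collect ultra. X \<subseteq> V"
        using \<C>(2) ultra_closedD by (metis all_not_in_conv mem_Collect_eq)
    qed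
    then obtain U where U: "ultra U" "?F \<subseteq> U" by blast
    have "U \<in> C" if "C \<in> \<C>" for C
      by (rule ultra_closed_mem) (use that \<C> U in blast)+
    then have "\<Inter>\<C> \<noteq> {}" by blast
    moreover have "ultra_closed (\<Inter>\<C>)"
      unfolding ultra_closed_def
    proof (intro conjI allI impI)
      show "\<Inter>\<C> \<subseteq> Collect ultra" using C0 \<C>(2) ultra_closedD by blast
    next
      fix U assume "ultra U" and U': "\<forall>A\<in>U. \<exists>V\<in>\<Inter>\<C>. A \<in> V"
      show "U \<in> \<Inter>\<C>"
      proof
        fix C assume "C \<in> \<C>"
        show "U \<in> C"
        proof (rule ultra_closed_mem)
          show "ultra_closed C" using \<C>(2) \<open>C \<in> \<C>\<close> by blast
          fix A assume "\<forall>V\<in>C. A \<in> V"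
          show "A \<in> U"
          proof (rule ccontr)
            assume "A \<notin> U"
            then have "- A \<in> U" using \<open>ultra U\<close> ultra_Compl by blast
            then obtain V where "V \<in> \<Inter>\<C>" "- A \<in> V" using U' by meson
            moreover from this have "A \<in> V" "ultra V"
              using \<open>C \<in> \<C>\<close> \<open>\<forall>V\<in>C. A \<in> V\<close> \<C>(2)[of C] ultra_closedD[of C V] by auto
            ultimately show False using ultra_Compl by blast
          qed
        qed fact
      qed
    qed
    moreover have "P (\<Inter>\<C>)" using P \<C> by blast
    moreover have "- \<Union>\<D> = \<Inter>\<C>" unfolding \<C>_def by auto
    ultimately show "\<Union>\<D> \<in> ?A" by simp
  qed
  then obtain M where M: "M \<in> ?A" and max: "\<forall>N\<in>?A. M \<subseteq> N \<longrightarrow> N = M" by (rule bexE)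
  have "N = - M" if "ultra_closed N" "N \<noteq> {}" "P N" "N \<subseteq> - M" for N
  proof -
    have "- N \<in> ?A" "M \<subseteq> - N" using that by auto
    then have "- N = M" by (rule max[rule_format])
    then show ?thesis by auto
  qed
  then show thesis using that[of "- M"] M by blast
qed

section \<open>The semigroup of ultrafilters on words\<close>

definition ultra_mult :: "'a list set set \<Rightarrow> 'a list set set \<Rightarrow> 'a list set set" (infixl "\<odot>" 70) where
  "U \<odot> V = {A. {s. {t. s @ t \<in> A} \<in> V} \<in> U}"

definition ultra_map :: "('a \<Rightarrow> 'b) \<Rightarrow> 'a set set \<Rightarrow> 'b set set" where
  "ultra_map f U = {A. f -` A \<in> U}"

lemma mem_ultra_mult: "A \<in> U \<odot> V \<longleftrightarrow> {s. {t. s @ t \<in> A} \<in> V} \<in> U"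
  by (simp add: ultra_mult_def)

text \<open>\<open>ultra\<close> says that membership is a Boolean homomorphism; in this form it
  passes through the nested memberships of the product by rewriting.\<close>

lemma ultra_mult_ultra: "ultra U \<Longrightarrow> ultra V \<Longrightarrow> ultra (U \<odot> V)"
  by (simp add: ultra_def mem_ultra_mult Collect_conj_eq flip: Collect_neg_eq)
     (simp add: Collect_conj_eq Collect_neg_eq)

lemma ultra_map_ultra: "ultra U \<Longrightarrow> ultra (ultra_map f U)"
  by (simp add: ultra_def ultra_map_def vimage_Compl)

lemma ultra_mult_assoc: "U \<odot> V \<odot> W = U \<odot> (V \<odot> W)"
  by (simp add: ultra_mult_def)

lemma ultra_map_mult:
  assumes "\<And>s t. f (s @ t) = f s @ f t"
  shows "ultra_map f (U \<odot> V) = ultra_map f U \<odot> ultra_map f V"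
  by (simp add: ultra_mult_def ultra_map_def vimage_def assms)

lemma ultra_principal: "ultra {A. x \<in> A}"
  by (simp add: ultra_def)

text \<open>Right multiplication by \<open>p\<close> is continuous: A lies in
  \<open>v \<odot> p\<close> iff \<open>?g A\<close> lies in v. By compactness some point of
  \<open>C\<close> contains all \<open>?g A\<close> with A in \<open>U\<close>, and it is a preimage
  of \<open>U\<close>.\<close>

lemma ultra_closed_mult_image:
  assumes C: "ultra_closed C" and p: "ultra p"
  shows "ultra_closed ((\<lambda>v. v \<odot> p) ` C)"
  unfolding ultra_closed_def
proof (intro conjI allI impI)
  show "(\<lambda>v. v \<odot> p) ` C \<subseteq> Collect ultra"
    using C p ultra_mult_ultra ultra_closedD by blast
next
  fix U assume U: "ultra U" "\<forall>A\<in>U. \<exists>V\<in>(\<lambda>v. v \<odot> p) ` C. A \<in> V"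
  let ?g = "\<lambda>A. {s. {t. s @ t \<in> A} \<in> p}"
  have "\<exists>v\<in>C. ?g ` U \<subseteq> v"
  proof (rule ultra_closed_compact[OF C])
    fix X assume "finite X" "X \<subseteq> ?g ` U"
    then obtain Y where Y: "Y \<subseteq> U" "finite Y" "X = ?g ` Y" by (meson finite_subset_image)
    then have "\<Inter>Y \<in> U" using U(1) ultra_Inter by blast
    then obtain v where v: "v \<in> C" "\<Inter>Y \<in> v \<odot> p" using U(2) by blast
    moreover have "ultra (v \<odot> p)"
      using ultra_mult_ultra[OF ultra_closedD[OF C v(1)] p] .
    ultimately have "Y \<subseteq> v \<odot> p" using Y(2) ultra_Inter by metis
    then have "X \<subseteq> v" unfolding Y(3) by (auto simp: mem_ultra_mult)
    then show "\<exists>V\<in>C. X \<subseteq> V" using v by blast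
  qed
  then obtain v where v: "v \<in> C" "?g ` U \<subseteq> v" by blast
  then have "U \<subseteq> v \<odot> p" by (simp add: subset_iff mem_ultra_mult)
  then have "U = v \<odot> p"
    using ultra_subset_eq[OF U(1) ultra_mult_ultra[OF ultra_closedD[OF C v(1)] p]] by simp
  then show "U \<in> (\<lambda>v. v \<odot> p) ` C" using v by blast
qed

lemma ultra_closed_mult_fix:
  assumes M: "ultra_closed M" and m: "ultra m"
  shows "ultra_closed {v \<in> M. v \<odot> m = m}"
  unfolding ultra_closed_def
proof (intro conjI allI impI)
  show "{v \<in> M. v \<odot> m = m} \<subseteq> Collect ultra" using M ultra_closedD by blast
next
  fix U assume U: "ultra U" "\<forall>A\<in>U. \<exists>V\<in>{v \<in> M. v \<odot> m = m}. A \<in> V"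
  have "m \<subseteq> U \<odot> m"
  proof (rule subsetI, rule ccontr)
    fix A assume A: "A \<in> m" "A \<notin> U \<odot> m"
    let ?B = "{s. {t. s @ t \<in> A} \<in> m}"
    have "- ?B \<in> U" using A U(1) by (simp add: mem_ultra_mult ultra_Compl)
    then obtain v where v: "v \<in> M" "v \<odot> m = m" "- ?B \<in> v" using U(2) by blast
    then have "?B \<in> v" using A(1) by (metis mem_ultra_mult)
    then show False using v M ultra_Compl ultra_closedD by blast
  qed
  then have "m = U \<odot> m" using U(1) m ultra_mult_ultra ultra_subset_eq by blast
  moreover have "U \<in> M" using U M unfolding ultra_closed_def by blast
  ultimately show "U \<in> {v \<in> M. v \<odot> m = m}" by simp
qed

text \<open>The Ellis-Numakura argument. In a minimal closed subsemigroup M, first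
  \<open>M \<odot> m\<close> equals M, which gives some v with \<open>v \<odot> m = m\<close>; then
  the set of these v equals M and so contains m.\<close>

lemma ultra_idempotent_exists:
  assumes "ultra_closed C" "C \<noteq> {}" "\<And>u v. u \<in> C \<Longrightarrow> v \<in> C \<Longrightarrow> u \<odot> v \<in> C"
  shows "\<exists>e\<in>C. e \<odot> e = e"
proof -
  let ?P = "\<lambda>D. D \<subseteq> C \<and> (\<forall>u\<in>D. \<forall>v\<in>D. u \<odot> v \<in> D)"
  obtain M where M: "ultra_closed M" "M \<noteq> {}" "?P M"
    and min: "\<And>N. ultra_closed N \<Longrightarrow> N \<noteq> {} \<Longrightarrow> ?P N \<Longrightarrow> N \<subseteq> M \<Longrightarrow> N = M"
  proof (rule minimal_ultra_closed[of C ?P])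
    show "?P C" using assms(3) by simp
    show "?P (\<Inter>\<C>)" if "\<C> \<noteq> {}" "\<And>D. D \<in> \<C> \<Longrightarrow> ?P D" for \<C>
    proof (intro conjI ballI InterI)
      show "\<Inter>\<C> \<subseteq> C" using that by auto
      show "u \<odot> v \<in> D" if "u \<in> \<Inter>\<C>" "v \<in> \<Inter>\<C>" "D \<in> \<C>" for u v D
        using that \<open>\<And>D. D \<in> \<C> \<Longrightarrow> ?P D\<close>[of D] by simp
    qed
  qed (use assms in simp_all)
  obtain m where m: "m \<in> M" using M(2) by blast
  have um: "ultra m" using m M(1) ultra_closedD by blast
  let ?N = "(\<lambda>v. v \<odot> m) ` M"
  have sub: "?N \<subseteq> M" using M(3) m by blast
  have "u \<odot> m \<odot> (v \<odot> m) \<in> ?N" if "u \<in> M" "v \<in> M" for u v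
  proof -
    have "u \<odot> m \<odot> (v \<odot> m) = (u \<odot> m \<odot> v) \<odot> m" by (simp add: ultra_mult_assoc)
    moreover have "u \<odot> m \<odot> v \<in> M" using M(3) m that by blast
    ultimately show ?thesis by blast
  qed
  then have "?N = M"
    using M m sub by (intro min ultra_closed_mult_image um) auto
  let ?K = "{v \<in> M. v \<odot> m = m}"
  have "m \<in> ?N" using \<open>?N = M\<close> m by simp
  then obtain v where "m = v \<odot> m" "v \<in> M" by (rule imageE)
  then have "?K \<noteq> {}" by auto
  moreover have "?P ?K" using M(3) by (auto simp: ultra_mult_assoc)
  ultimately have "?K = M" using M by (intro min ultra_closed_mult_fix um) auto
  then show ?thesis using m M(3) by blast
qed

text \<open>For z in a minimal closed left ideal L, the closed left ideal \<open>L \<odot> z\<close>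
  is all of L. So each y in L is some \<open>v \<odot> z\<close>, and an idempotent z acts as a
  right identity.\<close>

lemma minimal_left_ideal_exists:
  obtains L :: "'a list set set set" where "ultra_closed L" "L \<noteq> {}"
    "\<And>u v. ultra u \<Longrightarrow> v \<in> L \<Longrightarrow> u \<odot> v \<in> L"
    "\<And>y z. y \<in> L \<Longrightarrow> z \<in> L \<Longrightarrow> z \<odot> z = z \<Longrightarrow> y \<odot> z = y"
proof -
  let ?P = "\<lambda>D :: 'a list set set set. \<forall>u v. ultra u \<longrightarrow> v \<in> D \<longrightarrow> u \<odot> v \<in> D"
  obtain L where L: "ultra_closed L" "L \<noteq> {}" "?P L"
    and min: "\<And>N. ultra_closed N \<Longrightarrow> N \<noteq> {} \<Longrightarrow> ?P N \<Longrightarrow> N \<subseteq> L \<Longrightarrow> N = L"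
  proof (rule minimal_ultra_closed[of "Collect ultra" ?P])
    have "{A. ([] :: 'a list) \<in> A} \<in> Collect ultra" by (simp add: ultra_principal)
    then show "Collect ultra \<noteq> ({} :: 'a list set set set)" by (metis empty_iff)
    show "?P (Collect ultra)" by (simp add: ultra_mult_ultra)
    show "?P (\<Inter>\<C>)" if "\<C> \<noteq> {}" "\<And>D. D \<in> \<C> \<Longrightarrow> ?P D" for \<C>
      using that(2) by simp
  qed (use ultra_closed_all in simp_all)
  have "y \<odot> z = y" if "y \<in> L" "z \<in> L" "z \<odot> z = z" for y z
  proof -
    let ?N = "(\<lambda>v. v \<odot> z) ` L"
    have z: "ultra z" using that(2) L(1) ultra_closedD by blast
    have "?P ?N" using L(3) by (auto simp flip: ultra_mult_assoc)
    moreover have "?N \<subseteq> L" using L(1,3) that(2) ultra_closedD by blast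
    ultimately have "?N = L" using L by (intro min ultra_closed_mult_image z) auto
    then have "y \<in> ?N" using that(1) by simp
    then obtain v where "y = v \<odot> z" by (rule imageE)
    then show ?thesis by (simp add: ultra_mult_assoc that(3))
  qed
  then show thesis using that L by blast
qed

section \<open>Variable words and their idempotent\<close>

definition subst :: "'a \<Rightarrow> 'a option list \<Rightarrow> 'a list" where
  "subst a = map (case_option a id)"

lemma subst_append: "subst a (s @ t) = subst a s @ subst a t"
  by (simp add: subst_def)

text \<open>\<open>None\<close> is the variable. In first position it lets a substitution control
  the very next letter, on which \<open>prefix_blk_subst\<close> relies.\<close>

definition left_variable :: "'a option list \<Rightarrow> bool" where
  "left_variable w \<longleftrightarrow> w \<noteq> [] \<and> hd w = None"

text \<open>The idempotent is found in V p, where V is the right ideal of ultrafilters on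
  left-variable words and p lies in a minimal left ideal L. Every substitution fixes p, so it maps
  the idempotent into L, where idempotents are right identities.\<close>

lemma left_variable_ultra_exists:
  obtains e :: "'a option list set set" where "ultra e" "Collect left_variable \<in> e"
    "\<And>a b. ultra_map (subst a) e \<odot> ultra_map (subst b) e = ultra_map (subst a) e"
proof -
  obtain L :: "'a list set set set" where L: "ultra_closed L" "L \<noteq> {}"
    and ideal: "\<And>u v. ultra u \<Longrightarrow> v \<in> L \<Longrightarrow> u \<odot> v \<in> L"
    and idem: "\<And>y z. y \<in> L \<Longrightarrow> z \<in> L \<Longrightarrow> z \<odot> z = z \<Longrightarrow> y \<odot> z = y"
    using minimal_left_ideal_exists by blast
  obtain p where p: "p \<in> L" "ultra p" using L ultra_closedD by blast
  \<comment> \<open>\<open>q\<close> is \<open>p\<close> transported to words without a variable, so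
    every substitution brings it back to \<open>p\<close>.\<close>
  define q where "q = ultra_map (map Some) p"
  have q: "ultra q" using p ultra_map_ultra q_def by blast
  have subst_Some: "subst a (map Some w) = w" for a and w :: "'a list"
    by (simp add: subst_def comp_def)
  have sub_q: "ultra_map (subst a) q = p" for a
    by (simp add: q_def ultra_map_def vimage_def subst_Some)
  let ?V = "{v. ultra v \<and> Collect left_variable \<in> v}"
  \<comment> \<open>Appending keeps the first letter, so \<open>?V\<close> is a right ideal.\<close>
  have V_mult: "v \<odot> u \<in> ?V" if "v \<in> ?V" "ultra u" for v u :: "'a option list set set"
  proof -
    have "Collect left_variable \<subseteq> {s. {t. s @ t \<in> Collect left_variable} \<in> u}"
      using that(2) by (auto simp: left_variable_def ultra_UNIV)
    then show ?thesis using that ultra_mono ultra_mult_ultra by (simp add: mem_ultra_mult) blast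
  qed
  let ?C = "(\<lambda>v. v \<odot> q) ` ?V"
  have "\<exists>e\<in>?C. e \<odot> e = e"
  proof (rule ultra_idempotent_exists)
    show "ultra_closed ?C" by (intro ultra_closed_mult_image ultra_closed_Collect q)
    have "{A. [None] \<in> A} \<in> ?V" by (simp add: ultra_principal left_variable_def)
    then show "?C \<noteq> {}" by blast
    fix u v assume "u \<in> ?C" "v \<in> ?C"
    then obtain u' v' where "u' \<in> ?V" "v' \<in> ?V" "u = u' \<odot> q" "v = v' \<odot> q" by blast
    moreover from this have "u \<odot> v = (u' \<odot> (q \<odot> v')) \<odot> q" by (simp add: ultra_mult_assoc)
    ultimately show "u \<odot> v \<in> ?C" using V_mult ultra_mult_ultra q by blast
  qed
  then obtain v where v: "v \<in> ?V" and e: "v \<odot> q \<odot> (v \<odot> q) = v \<odot> q" by blast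
  let ?e = "v \<odot> q"
  \<comment> \<open>After substitution the right factor is \<open>p\<close>, and \<open>L\<close>
    absorbs products from the left.\<close>
  have inL: "ultra_map (subst a) ?e \<in> L" for a
    using v ideal p by (simp add: ultra_map_mult subst_append sub_q ultra_map_ultra)
  have "ultra_map (subst a) ?e \<odot> ultra_map (subst b) ?e = ultra_map (subst a) ?e" for a b
    by (rule idem[OF inL inL]) (metis e ultra_map_mult subst_append)
  then show thesis using that[of ?e] V_mult[OF v q] by blast
qed

section \<open>The Carlson--Simpson theorem\<close>

text \<open>The Galvin-Glazer argument, with \<open>E a \<odot> E b = E a\<close> in place of
  idempotence, so that letters may be mixed. One \<open>y\<close> serves a whole finite set of
  words, which allows iteration without \<open>y\<close> depending on earlier letters.\<close>

theorem carlson_simpson: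
  fixes c :: "'a list \<Rightarrow> 'b" and \<Lambda> :: "'a set"
  assumes fin: "finite (range c)" "finite \<Lambda>" and ne: "\<Lambda> \<noteq> {}"
  obtains A v where "A \<noteq> {}" "\<And>w. w \<in> A \<Longrightarrow> c w = v"
    "\<And>F. finite F \<Longrightarrow> F \<subseteq> A \<Longrightarrow>
       \<exists>y. left_variable y \<and> (\<forall>w\<in>F. \<forall>a\<in>\<Lambda>. w @ subst a y \<in> A)"
proof -
  obtain e :: "'a option list set set" where e: "ultra e" "Collect left_variable \<in> e"
    and idem: "\<And>a b. ultra_map (subst a) e \<odot> ultra_map (subst b) e = ultra_map (subst a) e"
    using left_variable_ultra_exists by blast
  define E where "E a = ultra_map (subst a) e" for a
  have uE: "ultra (E a)" for a using e ultra_map_ultra E_def by metis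
  have EE: "E a \<odot> E b = E a" for a b by (simp add: E_def idem)
  obtain a0 where "a0 \<in> \<Lambda>" using ne by blast
  have "\<exists>v. c -` {v} \<in> E a0"
  proof (rule ccontr)
    assume "\<nexists>v. c -` {v} \<in> E a0"
    then have "(\<lambda>v. - (c -` {v})) ` range c \<subseteq> E a0" using ultra_Compl[OF uE] by blast
    then have "\<Inter>((\<lambda>v. - (c -` {v})) ` range c) \<in> E a0"
      using ultra_Inter[OF uE] fin(1) by blast
    moreover have "\<Inter>((\<lambda>v. - (c -` {v})) ` range c) = {}" by auto
    ultimately show False using ultra_empty[OF uE] by metis
  qed
  then obtain v where v: "c -` {v} \<in> E a0" by blast
  \<comment> \<open>The words of color \<open>v\<close> whose extensions, for each letter
    \<open>a\<close> and \<open>E a\<close>-almost always, have color \<open>v\<close> too.\<close>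
  define A where "A = c -` {v} \<inter> (\<Inter>a\<in>\<Lambda>. {w. {t. w @ t \<in> c -` {v}} \<in> E a})"
  have memA: "w \<in> A \<longleftrightarrow> c w = v \<and> (\<forall>a\<in>\<Lambda>. {t. w @ t \<in> c -` {v}} \<in> E a)" for w
    by (auto simp: A_def)
  have AE: "A \<in> E a0"
  proof -
    have "(\<lambda>a. {w. {t. w @ t \<in> c -` {v}} \<in> E a}) ` \<Lambda> \<subseteq> E a0"
    proof (rule image_subsetI)
      show "{w. {t. w @ t \<in> c -` {v}} \<in> E a} \<in> E a0" for a
        using v EE[of a0 a] by (metis mem_ultra_mult)
    qed
    then have "(\<Inter>a\<in>\<Lambda>. {w. {t. w @ t \<in> c -` {v}} \<in> E a}) \<in> E a0"
      using ultra_Inter[OF uE] fin(2) by blast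
    then show ?thesis unfolding A_def using v ultra_Int[OF uE] by blast
  qed
  \<comment> \<open>What makes iteration possible: almost every extension of a word of
    \<open>A\<close> is again in \<open>A\<close>, by one more use of \<open>EE\<close>.\<close>
  have shift: "{t. w @ t \<in> A} \<in> E a" if w: "w \<in> A" and a: "a \<in> \<Lambda>" for w a
  proof -
    let ?B = "{t. w @ t \<in> c -` {v}}"
    have B: "?B \<in> E a" using w a memA by blast
    have "{s. {t. s @ t \<in> ?B} \<in> E b} \<in> E a" for b
      using B EE mem_ultra_mult by metis
    then have "(\<lambda>b. {s. {t. s @ t \<in> ?B} \<in> E b}) ` \<Lambda> \<subseteq> E a" by blast
    then have "(\<Inter>b\<in>\<Lambda>. {s. {t. s @ t \<in> ?B} \<in> E b}) \<in> E a"
      using ultra_Inter[OF uE] fin(2) by blast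
    then have "?B \<inter> (\<Inter>b\<in>\<Lambda>. {s. {t. s @ t \<in> ?B} \<in> E b}) \<in> E a"
      using B ultra_Int[OF uE] by blast
    then show ?thesis by (rule ultra_mono[OF uE]) (auto simp: memA)
  qed
  have "\<exists>y. left_variable y \<and> (\<forall>w\<in>F. \<forall>a\<in>\<Lambda>. w @ subst a y \<in> A)"
    if F: "finite F" "F \<subseteq> A" for F
  proof -
    \<comment> \<open>Each requirement is pulled back along its substitution to a set of variable
      words in \<open>e\<close>; there are finitely many of them.\<close>
    let ?X = "(\<lambda>(w, a). subst a -` {t. w @ t \<in> A}) ` (F \<times> \<Lambda>)"
    have "?X \<subseteq> e" using shift F(2) by (auto simp: E_def ultra_map_def)
    moreover have "finite ?X" using F(1) fin(2) by simp
    ultimately have "\<Inter>?X \<in> e" using ultra_Inter[OF e(1)] by metis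
    then have "Collect left_variable \<inter> \<Inter>?X \<in> e" using e ultra_Int by blast
    then have "Collect left_variable \<inter> \<Inter>?X \<noteq> {}" using ultra_empty[OF e(1)] by metis
    then show ?thesis by auto
  qed
  moreover have "A \<noteq> {}" using AE ultra_empty[OF uE] by metis
  ultimately show thesis using that memA by metis
qed

section \<open>Sequences of left-variable words\<close>

definition cs_word :: "'a list \<Rightarrow> (nat \<Rightarrow> 'a option list) \<Rightarrow> 'a list \<Rightarrow> 'a list" where
  "cs_word w0 Y ds = w0 @ concat (map (\<lambda>i. subst (ds ! i) (Y i)) [0..<length ds])"

lemma cs_word_snoc: "cs_word w0 Y (ds @ [d]) = cs_word w0 Y ds @ subst d (Y (length ds))"
proof -
  have "map (\<lambda>i. subst ((ds @ [d]) ! i) (Y i)) [0..<length ds] = map (\<lambda>i. subst (ds ! i) (Y i)) [0..<length ds]"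
    by (simp add: nth_append)
  then show ?thesis by (simp add: cs_word_def del: map_eq_conv)
qed

lemma length_cs_word: "length (cs_word w0 Y ds) = length w0 + (\<Sum>i<length ds. length (Y i))"
proof (induction ds rule: rev_induct)
  case Nil
  then show ?case by (simp add: cs_word_def)
next
  case (snoc d ds)
  then show ?case by (simp add: cs_word_snoc subst_def)
qed

text \<open>\<open>F i\<close> collects all words after i substitutions. It is finite, so a single
  \<open>y (F i)\<close> fits every choice of the earlier letters.\<close>

corollary carlson_simpson_sequence:
  fixes c :: "'a list \<Rightarrow> 'b" and \<Lambda> :: "'a set"
  assumes "finite (range c)" "finite \<Lambda>" "\<Lambda> \<noteq> {}"
  obtains w0 Y v where "\<And>i. left_variable (Y i)"
    "\<And>ds. set ds \<subseteq> \<Lambda> \<Longrightarrow> c (cs_word w0 Y ds) = v"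
proof -
  obtain A v where A: "A \<noteq> {}" "\<And>w. w \<in> A \<Longrightarrow> c w = v"
    and ext: "\<And>F. finite F \<Longrightarrow> F \<subseteq> A \<Longrightarrow>
       \<exists>y. left_variable y \<and> (\<forall>w\<in>F. \<forall>a\<in>\<Lambda>. w @ subst a y \<in> A)"
    using carlson_simpson[OF assms] by blast
  obtain w0 where w0: "w0 \<in> A" using A(1) by blast
  obtain y where y: "\<And>F. finite F \<Longrightarrow> F \<subseteq> A \<Longrightarrow>
      left_variable (y F) \<and> (\<forall>w\<in>F. \<forall>a\<in>\<Lambda>. w @ subst a (y F) \<in> A)"
    using ext by metis
  define F where "F = rec_nat {w0} (\<lambda>_ G. (\<lambda>(w, a). w @ subst a (y G)) ` (G \<times> \<Lambda>))"
  have F_0: "F 0 = {w0}" and F_Suc: "F (Suc i) = (\<lambda>(w, a). w @ subst a (y (F i))) ` (F i \<times> \<Lambda>)" for i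
    by (simp_all add: F_def)
  have inv: "finite (F i) \<and> F i \<subseteq> A" for i
  proof (induction i)
    case 0
    then show ?case using w0 by (simp add: F_0)
  next
    case (Suc i)
    then show ?case using y[of "F i"] assms(2) by (auto simp: F_Suc)
  qed
  have mem: "set ds \<subseteq> \<Lambda> \<Longrightarrow> cs_word w0 (\<lambda>i. y (F i)) ds \<in> F (length ds)" for ds
  proof (induction ds rule: rev_induct)
    case Nil
    then show ?case by (simp add: F_0 cs_word_def)
  next
    case (snoc d ds)
    then have "(cs_word w0 (\<lambda>i. y (F i)) ds, d) \<in> F (length ds) \<times> \<Lambda>" by simp
    then show ?case by (simp add: F_Suc cs_word_snoc image_iff) blast
  qed
  show thesis
  proof
    show "left_variable (y (F i))" for i using y[of "F i"] inv[of i] by simp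
    show "c (cs_word w0 (\<lambda>i. y (F i)) ds) = v" if "set ds \<subseteq> \<Lambda>" for ds
      using mem[OF that] inv[of "length ds"] A(2) by (metis subsetD)
  qed
qed

section \<open>Level-preserving embeddings\<close>

text \<open>A coordinatization of a strong subtree by T: the level of an image depends only on the
  level of the node, and directions are kept. Levels of T may be skipped.\<close>

definition emb :: "(node \<Rightarrow> node) \<Rightarrow> bool" where
  "emb \<phi> \<longleftrightarrow> (\<forall>x y. length x = length y \<longrightarrow> length (\<phi> x) = length (\<phi> y)) \<and>
     (\<forall>x b. prefix (\<phi> x @ [b]) (\<phi> (x @ [b])))"

lemma emb_length: "emb \<phi> \<Longrightarrow> length x = length y \<Longrightarrow> length (\<phi> x) = length (\<phi> y)"
  unfolding emb_def by blast

lemma emb_snoc: "emb \<phi> \<Longrightarrow> prefix (\<phi> x @ [b]) (\<phi> (x @ [b]))"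
  unfolding emb_def by blast

lemma emb_append:
  assumes "emb \<phi>"
  shows "prefix (\<phi> x @ [b]) (\<phi> (x @ b # z))"
proof (induction z rule: rev_induct)
  case Nil
  then show ?case using assms by (simp add: emb_snoc)
next
  case (snoc c z)
  have "prefix (\<phi> (x @ b # z)) (\<phi> ((x @ b # z) @ [c]))"
    using emb_snoc[OF assms] by (rule append_prefixD)
  then show ?case using snoc prefix_order.trans by fastforce
qed

lemma emb_append_ex: "emb \<phi> \<Longrightarrow> \<exists>w. \<phi> (x @ b # z) = \<phi> x @ b # w"
  using emb_append[of \<phi> x b z] by (auto simp: prefix_def)

lemma emb_mono: "emb \<phi> \<Longrightarrow> prefix x y \<Longrightarrow> prefix (\<phi> x) (\<phi> y)"
  by (metis append_prefixD append.right_neutral emb_append neq_Nil_conv prefix_def prefix_order.refl)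

lemma emb_id: "emb id"
  by (simp add: emb_def)

lemma emb_comp:
  assumes "emb \<phi>" "emb \<psi>"
  shows "emb (\<phi> \<circ> \<psi>)"
  unfolding emb_def
proof (intro conjI allI impI)
  fix x :: node and b
  obtain w where "\<psi> (x @ [b]) = \<psi> x @ b # w" using emb_append_ex[OF assms(2), of x b "[]"] by blast
  then show "prefix ((\<phi> \<circ> \<psi>) x @ [b]) ((\<phi> \<circ> \<psi>) (x @ [b]))"
    using emb_append[OF assms(1)] by simp
next
  fix x y :: node assume "length x = length y"
  then show "length ((\<phi> \<circ> \<psi>) x) = length ((\<phi> \<circ> \<psi>) y)"
    unfolding comp_apply by (intro emb_length[OF assms(1)] emb_length[OF assms(2)])
qed

text \<open>The initial segment of y of the length of x lies on the level of x, so x may be replaced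
  by it. The second part is what clause (iv) of \<open>Em\<close> asks for.\<close>

lemma emb_length_less:
  assumes "emb \<phi>" "length x < length y"
  shows "length (\<phi> x) < length (\<phi> y)" and "\<phi> y ! length (\<phi> x) = y ! length x"
proof -
  have "length (\<phi> (take (length x) y)) = length (\<phi> x)"
    using assms(2) by (intro emb_length[OF assms(1)]) auto
  moreover obtain w where "\<phi> y = \<phi> (take (length x) y) @ (y ! length x) # w"
    using emb_append_ex[OF assms(1)] id_take_nth_drop[OF assms(2)] by metis
  ultimately show "length (\<phi> x) < length (\<phi> y)" "\<phi> y ! length (\<phi> x) = y ! length x"
    by (simp_all add: nth_append)
qed

lemma emb_length_less_iff: "emb \<phi> \<Longrightarrow> length (\<phi> x) < length (\<phi> y) \<longleftrightarrow> length x < length y"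
  by (metis emb_length emb_length_less(1) linorder_neqE_nat order_less_imp_not_less less_irrefl_nat)

section \<open>Meets under embeddings\<close>

lemma meet_append: "meet (p @ u) (p @ v) = p @ meet u v"
  by (induction p) (auto simp: meet_def)

lemma meet_prefix: "prefix (meet x y) x" "prefix (meet x y) y"
  by (simp_all add: meet_def longest_common_prefix_prefix1 longest_common_prefix_prefix2)

lemma meet_cases:
  obtains "meet x y = x" "prefix x y" | "meet x y = y" "prefix y x"
  | b u v where "x = meet x y @ b # u" "y = meet x y @ (\<not> b) # v"
proof -
  have "(meet x y = x \<and> prefix x y) \<or> (meet x y = y \<and> prefix y x) \<or>
    (\<exists>b u v. x = meet x y @ b # u \<and> y = meet x y @ (\<not> b) # v)"
    unfolding meet_def by (induction x y rule: longest_common_prefix.induct) auto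
  then show thesis using that by blast
qed

text \<open>Where x and y branch, their images continue the image of the meet with different
  bits.\<close>

lemma emb_meet:
  assumes "emb \<phi>"
  shows "\<phi> (meet x y) = meet (\<phi> x) (\<phi> y)"
proof (cases x y rule: meet_cases)
  case 1
  then have "prefix (\<phi> x) (\<phi> y)" using emb_mono assms by blast
  then show ?thesis using 1 meet_append[of "\<phi> x" "[]"] by (auto simp: prefix_def meet_def)
next
  case 2
  then have "prefix (\<phi> y) (\<phi> x)" using emb_mono assms by blast
  then show ?thesis using 2 meet_append[of "\<phi> y" _ "[]"] by (auto simp: prefix_def meet_def)
next
  case (3 b u v)
  obtain w w' where "\<phi> x = \<phi> (meet x y) @ b # w" "\<phi> y = \<phi> (meet x y) @ (\<not> b) # w'"
    using emb_append_ex[OF assms] 3 by metis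
  then show ?thesis by (simp add: meet_append) (simp add: meet_def)
qed

lemma prefix_iff_meet: "prefix x y \<longleftrightarrow> meet x y = x"
  by (metis meet_append meet_prefix(2) prefix_def append_Nil2 meet_def longest_common_prefix.simps(2))

lemma emb_inj: "emb \<phi> \<Longrightarrow> inj \<phi>"
proof (rule injI)
  fix x y assume \<phi>: "emb \<phi>" and eq: "\<phi> x = \<phi> y"
  then have "length x = length y"
    using emb_length_less_iff[OF \<phi>, of x y] emb_length_less_iff[OF \<phi>, of y x] by simp
  then show "x = y"
  proof (cases x y rule: meet_cases)
    case (3 b u v)
    then show ?thesis using emb_append_ex[OF \<phi>] eq by (metis same_append_eq list.inject)
  qed (auto simp: prefix_def)
qed

lemma emb_prefix_iff: "emb \<phi> \<Longrightarrow> prefix (\<phi> x) (\<phi> y) \<longleftrightarrow> prefix x y"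
  by (metis emb_inj emb_meet injD prefix_iff_meet)

lemma emb_strict_prefix_iff: "emb \<phi> \<Longrightarrow> strict_prefix (\<phi> x) (\<phi> y) \<longleftrightarrow> strict_prefix x y"
  by (metis emb_inj emb_prefix_iff injD prefix_order.less_le)

section \<open>Ranges of embeddings as strong subtrees\<close>

lemma strict_prefix_snocI: "strict_prefix x y \<Longrightarrow> \<exists>b. prefix (x @ [b]) y"
  by (auto simp: strict_prefix_def prefix_def) (metis append_Nil2 neq_Nil_conv)

text \<open>The predecessors of \<open>\<phi> x\<close> in the range are the images of the proper
  initial segments of x.\<close>

lemma emb_range_level:
  assumes "emb \<phi>"
  shows "level_of (range \<phi>) j = \<phi> ` {x. length x = j}"
proof -
  have "card {u \<in> range \<phi>. strict_prefix u (\<phi> x)} = length x" for x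
  proof -
    have "{u \<in> range \<phi>. strict_prefix u (\<phi> x)} = \<phi> ` {z. strict_prefix z x}"
      by (auto simp: emb_strict_prefix_iff[OF assms])
    also have "card \<dots> = card {z. strict_prefix z x}"
      using emb_inj[OF assms] by (intro card_image) (auto simp: inj_on_def)
    also have "{z. strict_prefix z x} = (\<lambda>i. take i x) ` {..<length x}"
    proof (intro set_eqI iffI)
      fix z assume "z \<in> {z. strict_prefix z x}"
      then show "z \<in> (\<lambda>i. take i x) ` {..<length x}"
        using prefix_length_less by (intro image_eqI[of _ _ "length z"]) (auto simp: strict_prefix_def prefix_def)
    next
      fix z assume "z \<in> (\<lambda>i. take i x) ` {..<length x}"
      then obtain i where "i < length x" "z = take i x" by auto
      then show "z \<in> {z. strict_prefix z x}"
        by (auto simp: strict_prefix_def take_is_prefix dest: arg_cong[where f = length])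
    qed
    also have "card \<dots> = length x"
      by (subst card_image) (auto simp: inj_on_def dest: arg_cong[where f = length])
    finally show ?thesis .
  qed
  then show ?thesis by (auto simp: level_of_def)
qed

lemma emb_range_imm_succ:
  assumes "emb \<phi>"
  shows "imm_succ_in (range \<phi>) (\<phi> x) u \<and> prefix (\<phi> x @ [b]) u \<longleftrightarrow> u = \<phi> (x @ [b])"
proof
  assume u: "imm_succ_in (range \<phi>) (\<phi> x) u \<and> prefix (\<phi> x @ [b]) u"
  then have "u \<in> range \<phi>" "strict_prefix (\<phi> x) u" unfolding imm_succ_in_def by blast+
  then obtain y where y: "u = \<phi> y" "strict_prefix x y"
    using emb_strict_prefix_iff[OF assms] by (metis imageE)
  then obtain c where c: "prefix (x @ [c]) y" using strict_prefix_snocI by blast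
  then have "prefix (\<phi> x @ [c]) u"
    using y(1) emb_snoc[OF assms] emb_mono[OF assms] prefix_order.trans by metis
  then have "c = b" using u by (auto simp: prefix_def)
  moreover have "\<not> strict_prefix (x @ [c]) y"
    using u y(1) emb_strict_prefix_iff[OF assms] unfolding imm_succ_in_def
    by (metis rangeI strict_prefixI' )
  ultimately show "u = \<phi> (x @ [b])" using c y(1) by (auto simp: strict_prefix_def)
next
  assume u: "u = \<phi> (x @ [b])"
  have "\<not> (strict_prefix x y \<and> strict_prefix y (x @ [b]))" for y
    by (auto simp: strict_prefix_def prefix_def) (metis append_Nil2 append_eq_append_conv2 append_is_Nil_conv butlast_append butlast_snoc same_append_eq)
  moreover have "strict_prefix x (x @ [b])" by (simp add: strict_prefix_def)
  ultimately show "imm_succ_in (range \<phi>) (\<phi> x) u \<and> prefix (\<phi> x @ [b]) u"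
    unfolding imm_succ_in_def u by (simp add: emb_strict_prefix_iff[OF assms] emb_snoc[OF assms])
qed

lemma emb_range_strong:
  assumes \<phi>: "emb \<phi>" and n: "\<And>x. length (\<phi> x) mod n = length x mod n"
  shows "range \<phi> \<in> strong_Sigma n"
proof -
  have "\<exists>r\<in>range \<phi>. \<forall>s\<in>range \<phi>. prefix r s"
  proof (intro bexI ballI)
    fix s assume "s \<in> range \<phi>"
    then obtain x where "s = \<phi> x" by (rule imageE)
    then show "prefix (\<phi> []) s" using emb_mono[OF \<phi>, of "[]" x] by simp
  qed simp
  moreover have "\<exists>l. \<forall>s\<in>level_of (range \<phi>) j. length s = l" for j
  proof (intro exI ballI)
    fix s assume "s \<in> level_of (range \<phi>) j"
    then obtain x where "length x = j" "s = \<phi> x"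
      unfolding emb_range_level[OF \<phi>] by auto
    then show "length s = length (\<phi> (replicate j False))"
      using emb_length[OF \<phi>, of x "replicate j False"] by simp
  qed
  moreover have "\<exists>!u. imm_succ_in (range \<phi>) s u \<and> prefix (s @ [b]) u" if "s \<in> range \<phi>" for s b
  proof -
    obtain x where "s = \<phi> x" using \<open>s \<in> range \<phi>\<close> by (rule imageE)
    then show ?thesis by (simp add: emb_range_imm_succ[OF \<phi>])
  qed
  moreover have "level_of (range \<phi>) j \<noteq> {}" for j
  proof -
    have "replicate j False \<in> {x. length x = j}" by simp
    then show ?thesis unfolding emb_range_level[OF \<phi>] by blast
  qed
  moreover have "Sigma n (length s) = Sigma n j" if s: "s \<in> level_of (range \<phi>) j" for s j
  proof -
    obtain x where "length x = j" "s = \<phi> x"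
      using s unfolding emb_range_level[OF \<phi>] by auto
    then show ?thesis using n[of x] by (simp add: Sigma_def)
  qed
  ultimately show ?thesis by (simp add: strong_Sigma_def strong_subtree_def)
qed

section \<open>Fusion\<close>

text \<open>A letter is a set of pairs (i, y), describing for every strand y a block of n bits, of
  which the i-th is set iff (i, y) belongs to the letter.\<close>

definition blk :: "nat \<Rightarrow> (nat \<times> 'b) set list \<Rightarrow> 'b \<Rightarrow> bool list" where
  "blk n w y = concat (map (\<lambda>f. map (\<lambda>i. (i, y) \<in> f) [0..<n]) w)"

lemma blk_append: "blk n (w @ w') y = blk n w y @ blk n w' y"
  by (simp add: blk_def)

lemma length_blk: "length (blk n w y) = n * length w"
  by (induction w) (simp_all add: blk_def)

text \<open>A strand reads only the pairs carrying its own node, so letters may be changed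
  elsewhere.\<close>

lemma blk_subst_cong:
  assumes "\<And>j. (j, y) \<in> d \<longleftrightarrow> (j, y) \<in> d'"
  shows "blk n (subst d t) y = blk n (subst d' t) y"
  by (induction t) (auto simp: blk_def subst_def assms split: option.splits)

lemma blk_cs_word_cong:
  assumes "length ds = length ds'"
    and "\<And>i j. i < length ds \<Longrightarrow> (j, y) \<in> ds ! i \<longleftrightarrow> (j, y) \<in> ds' ! i"
  shows "blk n (cs_word w0 Y ds) y = blk n (cs_word w0 Y ds') y"
  using assms
proof (induction ds arbitrary: ds' rule: rev_induct)
  case Nil
  then show ?case by simp
next
  case (snoc d ds es')
  then obtain ds' d' where es': "es' = ds' @ [d']" by (cases es' rule: rev_cases) auto
  note prems = snoc.prems[unfolded es']
  have "blk n (cs_word w0 Y ds) y = blk n (cs_word w0 Y ds') y"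
  proof (rule snoc.IH)
    show "length ds = length ds'" using prems by simp
    show "(j, y) \<in> ds ! i \<longleftrightarrow> (j, y) \<in> ds' ! i" if "i < length ds" for i j
      using prems(1) prems(2)[of i j] that by (simp add: nth_append)
  qed
  moreover have "blk n (subst d (Y (length ds))) y = blk n (subst d' (Y (length ds))) y"
    using prems(1) prems(2)[of "length ds"] by (intro blk_subst_cong) (simp add: nth_append)
  ultimately show ?case using prems(1) by (simp add: es' cs_word_snoc blk_append)
qed

text \<open>The leading variable turns the first block into the description of \<open>d\<close>
  itself: r zeros, then the bit.\<close>

lemma prefix_blk_subst:
  assumes "left_variable t" "r < n" "\<And>i. (i, y) \<in> d \<longleftrightarrow> i = r \<and> b"
  shows "prefix (replicate r False @ [b]) (blk n (subst d t) y)"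
proof -
  obtain t' where t: "t = None # t'"
    using assms(1) by (cases t) (auto simp: left_variable_def)
  have "[0..<n] = [0..<r] @ r # [Suc r..<n]"
    using assms(2) by (metis le_add1 less_imp_le_nat upt_add_eq_append le_add_diff_inverse upt_conv_Cons add_0)
  moreover have "map (\<lambda>i. (i, y) \<in> d) [0..<r] = replicate r False"
    by (rule nth_equalityI) (simp_all add: assms(3))
  ultimately show ?thesis by (simp add: t subst_def blk_def assms(3))
qed

text \<open>The least node that the image of x must extend once the previous level is fixed; the
  strands start at these nodes.\<close>

definition stem :: "(node \<Rightarrow> node) \<Rightarrow> node \<Rightarrow> node" where
  "stem \<psi> x = (if x = [] then [] else \<psi> (butlast x) @ [last x])"

lemma stem_prefix: "emb \<psi> \<Longrightarrow> prefix (stem \<psi> x) (\<psi> x)"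
  using emb_snoc[of \<psi> "butlast x" "last x"] by (cases x rule: rev_cases) (simp_all add: stem_def)

lemma length_stem_cong: "emb \<psi> \<Longrightarrow> length x = length y \<Longrightarrow> length (stem \<psi> x) = length (stem \<psi> y)"
  using emb_length[of \<psi> "butlast x" "butlast y"] by (auto simp: stem_def)

lemma length_less_stem:
  assumes "emb \<psi>" "length x < length y"
  shows "length (\<psi> x) < length (stem \<psi> y)"
proof -
  have "length x \<le> length (butlast y)" using assms(2) by simp
  then have "\<not> length (\<psi> (butlast y)) < length (\<psi> x)"
    using emb_length_less_iff[OF assms(1)] by simp
  then show ?thesis using assms(2) by (auto simp: stem_def)
qed

lemma stem_inj:
  assumes "emb \<psi>" "length x = length y" "stem \<psi> x = stem \<psi> y"
  shows "x = y"
proof (cases "x = []")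
  case False
  then have "y \<noteq> []" using assms(2) by auto
  then have "\<psi> (butlast x) = \<psi> (butlast y)" "last x = last y"
    using assms(3) False by (auto simp: stem_def)
  then have "butlast x = butlast y" using emb_inj[OF assms(1)] by (simp add: inj_eq)
  then have "butlast x @ [last x] = butlast y @ [last y]" using \<open>last x = last y\<close> by simp
  then show ?thesis unfolding append_butlast_last_id[OF False] append_butlast_last_id[OF \<open>y \<noteq> []\<close>] .
qed (use assms(2) in simp)

lemma finite_short_nodes: "finite {x :: node. length x < h}"
proof -
  have "{x :: node. length x < h} \<subseteq> {x. set x \<subseteq> UNIV \<and> length x \<le> h}" by auto
  then show ?thesis by (rule finite_subset) (rule finite_lists_length_le[OF finite])
qed

definition colored_emb :: "nat \<Rightarrow> (node \<Rightarrow> node) \<Rightarrow> bool" where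
  "colored_emb n \<phi> \<longleftrightarrow> emb \<phi> \<and> (\<forall>x. length (\<phi> x) mod n = length x mod n)"

text \<open>It speaks of all maps, not only of embeddings, because \<open>stem_step\<close>
  evaluates colorings at maps of which only the values up to level h are meaningful.\<close>

definition depends_upto :: "nat \<Rightarrow> ((node \<Rightarrow> node) \<Rightarrow> 'b) \<Rightarrow> bool" where
  "depends_upto h c \<longleftrightarrow> (\<forall>\<phi> \<phi>'. (\<forall>x. length x < h \<longrightarrow> \<phi> x = \<phi>' x) \<longrightarrow> c \<phi> = c \<phi>')"

text \<open>The pairs that a fusion must not distinguish. The residue at level h has to be kept as
  data, since no colored embedding can change it.\<close>

definition similar :: "nat \<Rightarrow> nat \<Rightarrow> (node \<Rightarrow> node) \<Rightarrow> (node \<Rightarrow> node) \<Rightarrow> bool" where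
  "similar n h \<psi> \<psi>' \<longleftrightarrow> emb \<psi> \<and> emb \<psi>' \<and> (\<forall>x. length x < h \<longrightarrow> \<psi> x = \<psi>' x) \<and>
     (\<forall>x. length x = h \<longrightarrow> length (\<psi> x) mod n = length (\<psi>' x) mod n)"

text \<open>Above a node y of level J, a node y @ z of length J + p is sent to whole blocks followed by
  p mod n zeros; the next bit of the branch is then put at position p mod n of the next block,
  which is why lengths modulo n are preserved.\<close>

definition cs_emb :: "nat \<Rightarrow> nat \<Rightarrow> (nat \<times> node) set list \<Rightarrow> (nat \<Rightarrow> (nat \<times> node) set option list) \<Rightarrow> node \<Rightarrow> node" where
  "cs_emb n J w0 Y x = (if length x < J then x else
     (let y = take J x; z = drop J x in
      y @ blk n (cs_word w0 Y (map (\<lambda>i. if z ! i then {i mod n} \<times> {y. length y = J} else {}) [0..<length z])) y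
        @ replicate (length z mod n) False))"

lemma cs_emb_append:
  assumes "length y = J"
  shows "cs_emb n J w0 Y (y @ z) =
    y @ blk n (cs_word w0 Y (map (\<lambda>i. if z ! i then {i mod n} \<times> {y. length y = J} else {}) [0..<length z])) y
      @ replicate (length z mod n) False"
  using assms by (simp add: cs_emb_def)

lemma length_cs_emb:
  assumes "J \<le> length x"
  shows "length (cs_emb n J w0 Y x) =
    J + n * (length w0 + (\<Sum>i<length x - J. length (Y i))) + (length x - J) mod n"
proof -
  have "length (take J x) = J" using assms by simp
  from cs_emb_append[OF this, of n w0 Y "drop J x"] show ?thesis
    by (simp add: length_blk length_cs_word assms)
qed

lemma colored_emb_cs_emb:
  assumes n: "n > 0" and Y: "\<And>i. left_variable (Y i)"
  shows "colored_emb n (cs_emb n J w0 Y)"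
proof -
  let ?\<Theta> = "cs_emb n J w0 Y"
  have "length (?\<Theta> x) = length (?\<Theta> y)" if "length x = length y" for x y
  proof (cases "length x < J")
    case True
    then show ?thesis using that by (simp add: cs_emb_def)
  next
    case False
    then show ?thesis using that by (simp add: length_cs_emb)
  qed
  moreover have "prefix (?\<Theta> x @ [b]) (?\<Theta> (x @ [b]))" for x b
  proof -
    consider "Suc (length x) < J" | "Suc (length x) = J" | "J \<le> length x" by linarith
    then show ?thesis
    proof cases
      case 1
      then show ?thesis by (simp add: cs_emb_def)
    next
      \<comment> \<open>The border between the identity and the new part: a node of level J is an
        initial segment of its image.\<close>
      case 2
      then have "length (x @ [b]) = J" by simp
      have "prefix (x @ [b]) (?\<Theta> ((x @ [b]) @ []))"
        unfolding cs_emb_append[OF \<open>length (x @ [b]) = J\<close>] by (rule prefixI[OF refl])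
      then have "prefix (x @ [b]) (?\<Theta> (x @ [b]))" by simp
      moreover have "?\<Theta> x = x" using 2 by (simp add: cs_emb_def)
      ultimately show ?thesis by simp
    next
      case 3
      define y z where "y = take J x" and "z = drop J x"
      have x: "x = y @ z" and y: "length y = J" using 3 by (simp_all add: y_def z_def)
      let ?L = "\<lambda>b i. if b then {i mod n} \<times> {y :: node. length y = J} else {}"
      let ?D = "\<lambda>z. map (\<lambda>i. ?L (z ! i) i) [0..<length z]"
      have D: "?D (z @ [b]) = ?D z @ [?L b (length z)]" by (simp add: nth_append)
      let ?U = "y @ blk n (cs_word w0 Y (?D z)) y"
      \<comment> \<open>The image of x ends with \<open>length z mod n\<close> zeros of padding; the
        block for the next bit starts with exactly these zeros and then that bit.\<close>
      have "prefix (replicate (length z mod n) False @ [b]) (blk n (subst (?L b (length z)) (Y (length z))) y)"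
        using n y by (intro prefix_blk_subst Y) auto
      then obtain v where v: "blk n (subst (?L b (length z)) (Y (length z))) y = (replicate (length z mod n) False @ [b]) @ v"
        by (auto simp: prefix_def)
      have "?\<Theta> (x @ [b]) = y @ blk n (cs_word w0 Y (?D (z @ [b]))) y @ replicate (length (z @ [b]) mod n) False"
        using cs_emb_append[OF y, of n w0 Y "z @ [b]"] by (simp only: x append_assoc)
      also have "\<dots> = (?U @ replicate (length z mod n) False @ [b]) @ v @ replicate (length (z @ [b]) mod n) False"
        unfolding D cs_word_snoc blk_append by (simp add: v)
      also have "?U @ replicate (length z mod n) False @ [b] = ?\<Theta> x @ [b]"
        unfolding x cs_emb_append[OF y] by simp
      finally show ?thesis by (metis prefixI)
    qed
  qed
  moreover have "length (?\<Theta> x) mod n = length x mod n" for x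
  proof (cases "length x < J")
    case True
    then show ?thesis by (simp add: cs_emb_def)
  next
    case False
    then obtain m where m: "length x = J + m" by (metis le_Suc_ex not_less)
    have "length (?\<Theta> x) mod n = (n * (length w0 + (\<Sum>i<m. length (Y i))) + (J + m mod n)) mod n"
      using False by (simp add: length_cs_emb m ac_simps)
    also have "\<dots> = (J + m mod n) mod n" by (rule mod_mult_self4)
    also have "\<dots> = length x mod n" by (simp add: m mod_add_right_eq)
    finally show ?thesis .
  qed
  ultimately show ?thesis unfolding colored_emb_def emb_def by blast
qed

text \<open>A one-level form of the Halpern--Laeuchli theorem: all strands above level J are treated at
  once as a single word whose letters are indexed by the nodes of level J.\<close>

lemma stem_step:
  fixes c :: "(node \<Rightarrow> node) \<Rightarrow> 'b"
  assumes n: "n > 0" and fin: "finite (range c)" and dep: "depends_upto (Suc h) c"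
  shows "\<exists>\<Theta>. colored_emb n \<Theta> \<and> (\<forall>x. length x < J \<longrightarrow> \<Theta> x = x) \<and>
    (\<forall>\<psi> \<psi>'. similar n h \<psi> \<psi>' \<longrightarrow> (\<forall>x. length x = h \<longrightarrow> length (stem \<psi> x) = J) \<longrightarrow>
      c (\<Theta> \<circ> \<psi>) = c (\<Theta> \<circ> \<psi>'))"
proof -
  \<comment> \<open>Stems of length \<open>J\<close> force the values below level h to have length
    below \<open>J\<close>, so only finitely many restrictions occur.\<close>
  define Q where "Q = (\<Pi>\<^sub>E x\<in>{x :: node. length x < h}. {y :: node. length y < J})"
  define ext where "ext \<tau> Z x = (if length x < h then \<tau> x else Z (stem \<tau> x))"
    for \<tau> Z :: "node \<Rightarrow> node" and x
  define Z where "Z w r y = y @ blk n w y @ replicate r False"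
    for w :: "(nat \<times> node) set list" and r y
  \<comment> \<open>All restrictions and residues are tabulated in one finite coloring, so one
    homogeneous sequence serves them all.\<close>
  define G where "G w = restrict (\<lambda>(\<tau>, r). c (ext \<tau> (Z w r))) (Q \<times> {..<n})" for w
  have "finite (Q \<times> {..<n})"
    unfolding Q_def by (intro finite_cartesian_product finite_PiE finite_short_nodes) auto
  then have "finite (\<Pi>\<^sub>E q\<in>Q \<times> {..<n}. range c)"
    using fin by (intro finite_PiE)
  moreover have "range G \<subseteq> (\<Pi>\<^sub>E q\<in>Q \<times> {..<n}. range c)"
  proof (rule image_subsetI)
    show "G w \<in> (\<Pi>\<^sub>E q\<in>Q \<times> {..<n}. range c)" for w
      unfolding G_def restrict_PiE_iff by auto
  qed
  ultimately have "finite (range G)" using finite_subset by blast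
  moreover define \<Lambda> where "\<Lambda> = Pow ({..<n} \<times> {y :: node. length y = J})"
  have "finite {y :: node. length y = J}"
    by (rule finite_subset[OF _ finite_short_nodes[of "Suc J"]]) auto
  then have "finite \<Lambda>" by (simp add: \<Lambda>_def)
  moreover have "\<Lambda> \<noteq> {}" by (auto simp: \<Lambda>_def)
  ultimately obtain w0 Y v where Y: "\<And>i. left_variable (Y i)"
    and v: "\<And>ds. set ds \<subseteq> \<Lambda> \<Longrightarrow> G (cs_word w0 Y ds) = v"
    using carlson_simpson_sequence[of G \<Lambda>] by metis
  define \<Theta> where "\<Theta> = cs_emb n J w0 Y"
  \<comment> \<open>Only the residue of \<open>p\<close> survives, because \<open>v\<close> is the
    same for any number of substituted letters.\<close>
  have color_eq: "c (\<Theta> \<circ> \<psi>) = v (restrict \<psi> {x. length x < h}, p mod n)"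
    if \<psi>: "emb \<psi>" and stem: "\<And>x. length x = h \<Longrightarrow> length (stem \<psi> x) = J"
      and p: "\<And>x. length x = h \<Longrightarrow> length (\<psi> x) = J + p" for \<psi> p
  proof -
    let ?\<tau> = "restrict \<psi> {x. length x < h}"
    let ?E = "\<lambda>i. {y. \<exists>x. length x = h \<and> stem \<psi> x = y \<and> \<psi> x ! (J + i)}"
    \<comment> \<open>A strand receives a one in step i, at the position used by
      \<open>cs_emb\<close>, iff its branch has a one at place J + i.\<close>
    define ds where "ds = map (\<lambda>i. {i mod n} \<times> ?E i) [0..<p]"
    have "set ds \<subseteq> \<Lambda>" using n stem by (auto simp: ds_def \<Lambda>_def)
    have short: "length (\<psi> x) < J" if "length x < h" for x
      using length_less_stem[OF \<psi>, of x "replicate h False"] stem[of "replicate h False"] that by simp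
    have \<tau>: "?\<tau> \<in> Q" unfolding Q_def by (intro restrict_PiE_iff[THEN iffD2] ballI) (use short in simp)
    have stem_\<tau>: "stem ?\<tau> x = stem \<psi> x" if "length x = h" for x
      using that by (cases x) (auto simp: stem_def)
    have "(\<Theta> \<circ> \<psi>) x = ext ?\<tau> (Z (cs_word w0 Y ds) (p mod n)) x" if x: "length x < Suc h" for x
    proof (cases "length x < h")
      case True
      then show ?thesis using short[OF True] by (simp add: \<Theta>_def cs_emb_def ext_def)
    next
      case False
      then have h: "length x = h" using x by simp
      define y where "y = stem \<psi> x"
      obtain z where z: "\<psi> x = y @ z" using stem_prefix[OF \<psi>, of x] by (auto simp: y_def prefix_def)
      have y: "length y = J" using stem[OF h] by (simp add: y_def)
      have len: "length z = p" using p[OF h] y z by simp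
      let ?D = "map (\<lambda>i. if z ! i then {i mod n} \<times> {y :: node. length y = J} else {}) [0..<length z]"
      \<comment> \<open>The letters of \<open>cs_emb\<close> give the same bit to all strands, but
        on the strand y they agree with \<open>ds\<close>.\<close>
      have "blk n (cs_word w0 Y ?D) y = blk n (cs_word w0 Y ds) y"
      proof (rule blk_cs_word_cong)
        show "length ?D = length ds" by (simp add: ds_def len)
        fix i j assume "i < length ?D"
        then have i: "i < p" using len by simp
        have "y \<in> ?E i \<longleftrightarrow> z ! i"
        proof
          assume "y \<in> ?E i"
          then obtain x' where x': "length x' = h" "stem \<psi> x' = y" "\<psi> x' ! (J + i)" by blast
          \<comment> \<open>Distinct nodes of level h have distinct stems, so a strand carries the
            bits of a single branch.\<close>
          then have "x' = x" using stem_inj[OF \<psi>, of x' x] h by (simp add: y_def)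
          then show "z ! i" using x'(3) by (simp add: z nth_append y)
        next
          assume "z ! i"
          then have "\<psi> x ! (J + i)" by (simp add: z nth_append y)
          then show "y \<in> ?E i" using h y_def by blast
        qed
        then show "(j, y) \<in> ?D ! i \<longleftrightarrow> (j, y) \<in> ds ! i"
          using i y by (simp add: ds_def len)
      qed
      then have "\<Theta> (\<psi> x) = Z (cs_word w0 Y ds) (p mod n) y"
        unfolding z \<Theta>_def cs_emb_append[OF y] Z_def by (simp add: len)
      then show ?thesis using h stem_\<tau>[OF h] by (simp add: ext_def y_def)
    qed
    then have "c (\<Theta> \<circ> \<psi>) = c (ext ?\<tau> (Z (cs_word w0 Y ds) (p mod n)))"
      using dep unfolding depends_upto_def by blast
    also have "\<dots> = G (cs_word w0 Y ds) (?\<tau>, p mod n)"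
      using \<tau> n by (simp add: G_def)
    finally show ?thesis using v[OF \<open>set ds \<subseteq> \<Lambda>\<close>] by simp
  qed
  show ?thesis
  proof (intro exI[of _ \<Theta>] conjI allI impI)
    show "colored_emb n \<Theta>" unfolding \<Theta>_def by (rule colored_emb_cs_emb[OF n Y])
    show "\<Theta> x = x" if "length x < J" for x using that by (simp add: \<Theta>_def cs_emb_def)
    fix \<psi> \<psi>' assume sim: "similar n h \<psi> \<psi>'"
      and stems: "\<forall>x. length x = h \<longrightarrow> length (stem \<psi> x) = J"
    have \<psi>: "emb \<psi>" "emb \<psi>'" and agree: "\<And>x. length x < h \<Longrightarrow> \<psi> x = \<psi>' x"
      and stem: "\<And>x. length x = h \<Longrightarrow> length (stem \<psi> x) = J"
      and res: "\<And>x. length x = h \<Longrightarrow> length (\<psi> x) mod n = length (\<psi>' x) mod n"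
      using sim stems unfolding similar_def by blast+
    let ?o = "replicate h False"
    have stem': "length (stem \<psi>' x) = J" if "length x = h" for x
    proof -
      have "stem \<psi>' x = stem \<psi> x" using that agree[of "butlast x"] by (cases x) (auto simp: stem_def)
      then show ?thesis using stem[OF that] by simp
    qed
    have "J \<le> length (\<psi> ?o)" "J \<le> length (\<psi>' ?o)"
      using prefix_length_le[OF stem_prefix[OF \<psi>(1), of ?o]] stem[of ?o]
        prefix_length_le[OF stem_prefix[OF \<psi>(2), of ?o]] stem'[of ?o] by simp_all
    then obtain p p' where p: "length (\<psi> ?o) = J + p" "length (\<psi>' ?o) = J + p'"
      by (metis le_Suc_ex)
    have "p mod n = p' mod n"
      using res[of ?o] unfolding p by (simp add: nat_mod_eq_iff)
    moreover have "restrict \<psi> {x. length x < h} = restrict \<psi>' {x. length x < h}"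
      using agree by (intro restrict_ext) simp
    moreover have "length (\<psi> x) = J + p" "length (\<psi>' x) = J + p'" if "length x = h" for x
      using that p emb_length[OF \<psi>(1), of x ?o] emb_length[OF \<psi>(2), of x ?o] by simp_all
    ultimately show "c (\<Theta> \<circ> \<psi>) = c (\<Theta> \<circ> \<psi>')"
      using color_eq[OF \<psi>(1) stem, of p] color_eq[OF \<psi>(2) stem', of p'] by simp
  qed
qed

section \<open>Iteration over all levels\<close>

lemma colored_embD: "colored_emb n \<phi> \<Longrightarrow> emb \<phi>" "colored_emb n \<phi> \<Longrightarrow> length (\<phi> x) mod n = length x mod n"
  by (auto simp: colored_emb_def)

lemma colored_emb_id: "colored_emb n id"
  by (simp add: colored_emb_def emb_id)

lemma colored_emb_comp: "colored_emb n \<phi> \<Longrightarrow> colored_emb n \<psi> \<Longrightarrow> colored_emb n (\<phi> \<circ> \<psi>)"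
  unfolding colored_emb_def using emb_comp by auto

lemma depends_uptoD:
  "depends_upto h c \<Longrightarrow> (\<And>x. length x < h \<Longrightarrow> \<phi> x = \<phi>' x) \<Longrightarrow> c \<phi> = c \<phi>'"
  unfolding depends_upto_def by blast

text \<open>The step for level J fixes all nodes below J, so the iterates stabilize at each node. If
  the stems of psi have length J, later factors leave them in place, and the step made for J still
  applies.\<close>

lemma fusion:
  fixes c :: "(node \<Rightarrow> node) \<Rightarrow> 'b"
  assumes n: "n > 0" and fin: "finite (range c)" and dep: "depends_upto (Suc h) c"
  shows "\<exists>\<Phi>. colored_emb n \<Phi> \<and>
    (\<forall>\<psi> \<psi>'. similar n h \<psi> \<psi>' \<longrightarrow> c (\<Phi> \<circ> \<psi>) = c (\<Phi> \<circ> \<psi>'))"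
proof -
  define stems where "stems J \<psi> \<longleftrightarrow> (\<forall>x. length x = h \<longrightarrow> length (stem \<psi> x) = J)"
    for J and \<psi> :: "node \<Rightarrow> node"
  define good where "good \<Phi> J \<Theta> \<longleftrightarrow> colored_emb n \<Theta> \<and> (\<forall>x. length x < J \<longrightarrow> \<Theta> x = x) \<and>
      (\<forall>\<psi> \<psi>'. similar n h \<psi> \<psi>' \<longrightarrow> stems J \<psi> \<longrightarrow> c (\<Phi> \<circ> (\<Theta> \<circ> \<psi>)) = c (\<Phi> \<circ> (\<Theta> \<circ> \<psi>')))"
    for \<Phi> J \<Theta>
  have "\<exists>\<Theta>. good \<Phi> J \<Theta>" for \<Phi> J
  proof -
    let ?c = "\<lambda>\<psi>. c (\<Phi> \<circ> \<psi>)"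
    have "finite (range ?c)" by (rule finite_subset[OF _ fin]) auto
    moreover have "depends_upto (Suc h) ?c"
      unfolding depends_upto_def by (intro allI impI depends_uptoD[OF dep]) simp
    ultimately show ?thesis unfolding good_def stems_def by (rule stem_step[OF n])
  qed
  then obtain T where good: "\<And>\<Phi> J. good \<Phi> J (T \<Phi> J)" by metis
  have T: "colored_emb n (T \<Phi> J)" for \<Phi> J
    using good unfolding good_def by blast
  have T_id: "T \<Phi> J x = x" if "length x < J" for \<Phi> J x
    using good that unfolding good_def by blast
  have T_c: "c (\<Phi> \<circ> (T \<Phi> J \<circ> \<psi>)) = c (\<Phi> \<circ> (T \<Phi> J \<circ> \<psi>'))"
    if "similar n h \<psi> \<psi>'" "stems J \<psi>" for \<Phi> J \<psi> \<psi>'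
    using good that unfolding good_def by blast
  \<comment> \<open>Composition is on the right: the maps for higher levels act on psi
    first.\<close>
  define F where "F = rec_nat id (\<lambda>J \<Phi>. \<Phi> \<circ> T \<Phi> J)"
  have F_0: "F 0 = id" and F_Suc: "F (Suc J) = F J \<circ> T (F J) J" for J
    by (simp_all add: F_def)
  have F: "colored_emb n (F J)" for J
    by (induction J) (simp_all only: F_0 F_Suc colored_emb_id colored_emb_comp T)
  have F_stable: "F (J + m) x = F J x" if "length x < J" for J m x
    using that by (induction m) (simp_all add: F_Suc T_id)
  define \<Phi> where "\<Phi> x = F (Suc (length x)) x" for x
  have \<Phi>_F: "\<Phi> x = F M x" if "length x < M" for x M
    using F_stable[of x "Suc (length x)" "M - Suc (length x)"] that by (simp add: \<Phi>_def)
  have "colored_emb n \<Phi>"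
    unfolding colored_emb_def emb_def
  proof (intro conjI allI impI)
    fix x y :: node assume "length x = length y"
    then show "length (\<Phi> x) = length (\<Phi> y)"
      using emb_length[OF colored_embD(1)[OF F], of x y] by (simp add: \<Phi>_def)
  next
    fix x :: node and b
    have "\<Phi> x = F (Suc (Suc (length x))) x" by (rule \<Phi>_F) simp
    then show "prefix (\<Phi> x @ [b]) (\<Phi> (x @ [b]))"
      using emb_snoc[OF colored_embD(1)[OF F]] by (simp add: \<Phi>_def)
  next
    show "length (\<Phi> x) mod n = length x mod n" for x
      unfolding \<Phi>_def by (rule colored_embD(2)[OF F])
  qed
  moreover have "c (\<Phi> \<circ> \<psi>) = c (\<Phi> \<circ> \<psi>')" if sim: "similar n h \<psi> \<psi>'" for \<psi> \<psi>'
  proof -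
    let ?o = "replicate h False"
    have emb: "emb \<psi>" "emb \<psi>'" using sim by (auto simp: similar_def)
    define J where "J = length (stem \<psi> ?o)"
    have J: "length (stem \<psi> x) = J" if "length x = h" for x
      unfolding J_def using that by (intro length_stem_cong[OF emb(1)]) simp
    have F_M: "c (F (Suc J + m) \<circ> \<psi>) = c (F (Suc J + m) \<circ> \<psi>')" for m
    proof -
      \<comment> \<open>\<open>R\<close> gathers the factors after the step for \<open>J\<close>. It
        keeps psi and psi' similar and their stems unchanged.\<close>
      have "\<exists>R. colored_emb n R \<and> (\<forall>x. length x < J \<longrightarrow> R x = x) \<and> F (Suc J + m) = F (Suc J) \<circ> R"
      proof (induction m)
        case 0
        show ?case by (intro exI[of _ id] conjI colored_emb_id) simp_all
      next
        case (Suc m)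
        then obtain R where R: "colored_emb n R" "\<forall>x. length x < J \<longrightarrow> R x = x"
          "F (Suc J + m) = F (Suc J) \<circ> R" by blast
        let ?T = "T (F (Suc J + m)) (Suc J + m)"
        have "F (Suc J + Suc m) = F (Suc J) \<circ> (R \<circ> ?T)"
          using R(3) F_Suc[of "Suc J + m"] by (simp add: comp_assoc)
        moreover have "(R \<circ> ?T) x = x" if "length x < J" for x
          using R(2) T_id[of x "Suc J + m"] that by simp
        ultimately show ?case using colored_emb_comp[OF R(1) T] by blast
      qed
      then obtain R where R: "colored_emb n R" "\<And>x. length x < J \<Longrightarrow> R x = x"
        "F (Suc J + m) = F (Suc J) \<circ> R" by blast
      have "similar n h (R \<circ> \<psi>) (R \<circ> \<psi>')"
        using sim emb_comp[OF colored_embD(1)[OF R(1)]] unfolding similar_def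
        by (simp add: colored_embD(2)[OF R(1)])
      moreover have "stems J (R \<circ> \<psi>)"
        unfolding stems_def
      proof (intro allI impI)
        fix x :: node assume x: "length x = h"
        have "R (\<psi> (butlast x)) = \<psi> (butlast x)" if "x \<noteq> []"
          using length_less_stem[OF emb(1), of "butlast x" x] J[OF x] that by (intro R(2)) simp
        then have "stem (R \<circ> \<psi>) x = stem \<psi> x" by (simp add: stem_def)
        then show "length (stem (R \<circ> \<psi>) x) = J" using J[OF x] by simp
      qed
      ultimately show ?thesis using T_c[of "R \<circ> \<psi>" "R \<circ> \<psi>'" J "F J"] R(3)
        by (simp add: F_Suc comp_assoc)
    qed
    \<comment> \<open>Large enough for the limit to agree with a finite stage on all values of both
      embeddings up to level h.\<close>
    define m where "m = length (\<psi> ?o) + length (\<psi>' ?o)"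
    have \<Phi>_M: "c (\<Phi> \<circ> \<chi>) = c (F (Suc J + m) \<circ> \<chi>)" if \<chi>: "emb \<chi>" "length (\<chi> ?o) \<le> m" for \<chi>
    proof (rule depends_uptoD[OF dep])
      fix x :: node assume "length x < Suc h"
      then have "\<not> length (\<chi> ?o) < length (\<chi> x)" using emb_length_less_iff[OF \<chi>(1)] by simp
      then show "(\<Phi> \<circ> \<chi>) x = (F (Suc J + m) \<circ> \<chi>) x"
        using \<chi>(2) \<Phi>_F[of "\<chi> x" "Suc J + m"] by simp
    qed
    show ?thesis
      using F_M[of m] \<Phi>_M[OF emb(1)] \<Phi>_M[OF emb(2)] by (simp add: m_def)
  qed
  ultimately show ?thesis by blast
qed

text \<open>After a fusion level h enters only by its residue, which \<open>\<rho>\<close>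
  prescribes, so the color descends to a coloring of smaller depth.\<close>

theorem milliken_emb:
  fixes c :: "(node \<Rightarrow> node) \<Rightarrow> 'b" and \<rho> :: "nat \<Rightarrow> nat"
  assumes n: "n > 0" and "finite (range c)" "depends_upto h c"
  shows "\<exists>\<Phi> v. colored_emb n \<Phi> \<and> (\<forall>\<psi>. emb \<psi> \<longrightarrow>
      (\<forall>x. length x < h \<longrightarrow> length (\<psi> x) mod n = \<rho> (length x)) \<longrightarrow> c (\<Phi> \<circ> \<psi>) = v)"
  using assms(2,3)
proof (induction h arbitrary: c)
  case 0
  have "c \<phi> = c id" for \<phi> using depends_uptoD[OF 0(2)] by simp
  then show ?case using colored_emb_id by blast
next
  case (Suc h)
  obtain \<Phi>1 where \<Phi>1: "colored_emb n \<Phi>1" and c1: "\<And>\<psi> \<psi>'. similar n h \<psi> \<psi>' \<Longrightarrow> c (\<Phi>1 \<circ> \<psi>) = c (\<Phi>1 \<circ> \<psi>')"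
    using fusion[OF n Suc.prems] by blast
  define P where "P \<psi> \<psi>' \<longleftrightarrow> emb \<psi>' \<and> (\<forall>x. length x < h \<longrightarrow> \<psi>' x = \<psi> x) \<and>
    (\<forall>x. length x = h \<longrightarrow> length (\<psi>' x) mod n = \<rho> h)" for \<psi> \<psi>' :: "node \<Rightarrow> node"
  \<comment> \<open>All completions of an embedding by a level h of residue \<open>\<rho> h\<close>
    give the same color, so any may be chosen. If there is none, the value is arbitrary but still in
    the range of \<open>c\<close>.\<close>
  define c' where "c' \<psi> = c (\<Phi>1 \<circ> (SOME \<psi>'. P \<psi> \<psi>'))" for \<psi>
  have "finite (range c')"
    by (rule finite_subset[OF _ Suc.prems(1)]) (auto simp: c'_def)
  moreover have "depends_upto h c'"
    unfolding depends_upto_def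
  proof (intro allI impI)
    fix \<phi> \<phi>' :: "node \<Rightarrow> node" assume "\<forall>x. length x < h \<longrightarrow> \<phi> x = \<phi>' x"
    then have "P \<phi> = P \<phi>'" by (auto simp: P_def fun_eq_iff)
    then show "c' \<phi> = c' \<phi>'" by (simp add: c'_def)
  qed
  ultimately obtain \<Phi>2 v where \<Phi>2: "colored_emb n \<Phi>2" and v: "\<And>\<psi>. emb \<psi> \<Longrightarrow>
    (\<And>x. length x < h \<Longrightarrow> length (\<psi> x) mod n = \<rho> (length x)) \<Longrightarrow> c' (\<Phi>2 \<circ> \<psi>) = v"
    using Suc.IH[of c'] by blast
  have "c (\<Phi>1 \<circ> \<Phi>2 \<circ> \<psi>) = v"
    if \<psi>: "emb \<psi>" and \<rho>: "\<And>x. length x < Suc h \<Longrightarrow> length (\<psi> x) mod n = \<rho> (length x)" for \<psi>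
  proof -
    have "P (\<Phi>2 \<circ> \<psi>) (\<Phi>2 \<circ> \<psi>)"
      using emb_comp[OF colored_embD(1)[OF \<Phi>2] \<psi>] \<rho> by (simp add: P_def colored_embD(2)[OF \<Phi>2])
    define \<psi>' where "\<psi>' = (SOME \<psi>'. P (\<Phi>2 \<circ> \<psi>) \<psi>')"
    have "P (\<Phi>2 \<circ> \<psi>) \<psi>'"
      unfolding \<psi>'_def by (rule someI[of "P (\<Phi>2 \<circ> \<psi>)"]) fact
    then have "similar n h (\<Phi>2 \<circ> \<psi>) \<psi>'"
      using \<open>P (\<Phi>2 \<circ> \<psi>) (\<Phi>2 \<circ> \<psi>)\<close> by (simp add: P_def similar_def)
    then have "c (\<Phi>1 \<circ> (\<Phi>2 \<circ> \<psi>)) = c' (\<Phi>2 \<circ> \<psi>)"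
      unfolding c'_def \<psi>'_def[symmetric] by (rule c1)
    also have "\<dots> = v" using \<rho> by (intro v[OF \<psi>]) simp
    finally show ?thesis by (simp add: comp_assoc)
  qed
  then show ?case using colored_emb_comp[OF \<Phi>1 \<Phi>2] by blast
qed

section \<open>Similarity types\<close>

lemma meet_idem: "meet s s = s"
  using meet_append[of s "[]" "[]"] by (simp add: meet_def)

lemma subset_meet_closure: "A \<subseteq> meet_closure A"
proof
  fix s assume "s \<in> A"
  then have "meet s s \<in> meet_closure A" unfolding meet_closure_def by blast
  then show "s \<in> meet_closure A" by (simp add: meet_idem)
qed

text \<open>If u and v split, the elements of A above them split at the same node, so one round of
  meets suffices.\<close>

lemma meet_closure_closed:
  assumes "u \<in> meet_closure A" "v \<in> meet_closure A"
  shows "meet u v \<in> meet_closure A"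
proof (cases u v rule: meet_cases)
  case (3 b u' v')
  obtain s s' t t' where A: "s \<in> A" "s' \<in> A" "t \<in> A" "t' \<in> A" and uv: "u = meet s s'" "v = meet t t'"
    using assms unfolding meet_closure_def by blast
  have "prefix u s" "prefix v t" using uv meet_prefix by auto
  then obtain p q where "s = u @ p" "t = v @ q" by (auto simp: prefix_def)
  then have "s = meet u v @ b # (u' @ p)" "t = meet u v @ (\<not> b) # (v' @ q)"
    using 3 by (metis append_assoc append_Cons)+
  then have "meet s t = meet u v @ meet (b # (u' @ p)) ((\<not> b) # (v' @ q))"
    using meet_append by metis
  then have "meet s t = meet u v" by (simp add: meet_def)
  moreover have "meet s t \<in> meet_closure A" using A unfolding meet_closure_def by blast
  ultimately show ?thesis by simp
qed (use assms in simp_all)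

lemma take_eq_of_meet: "m \<le> length (meet s t) \<Longrightarrow> take m s = take m t"
  using meet_prefix[of s t] by (auto simp: prefix_def) (metis take_append diff_is_0_eq take_0 append_Nil2)

lemma length_meet_ge: "prefix p s \<Longrightarrow> prefix p t \<Longrightarrow> length p \<le> length (meet s t)"
  unfolding meet_def using longest_common_prefix_max_prefix prefix_length_le by blast

section \<open>Enumerating levels\<close>

lemma strict_mono_extension:
  fixes a :: "nat \<Rightarrow> nat"
  assumes "\<And>i j. i < j \<Longrightarrow> j < h \<Longrightarrow> a i < a j"
  shows "\<exists>l. strict_mono l \<and> (\<forall>i<h. l i = a i)"
proof -
  \<comment> \<open>From h on the values exceed the sum of the prescribed ones, hence each of
    them.\<close>
  let ?l = "\<lambda>i. if i < h then a i else (\<Sum>j<h. a j) + Suc i"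
  have le: "a i \<le> (\<Sum>j<h. a j)" if "i < h" for i
    using that by (intro member_le_sum) auto
  have "?l i < ?l (Suc i)" for i
    using assms[of i "Suc i"] le[of i] by (cases "Suc i < h") auto
  then have "strict_mono ?l" unfolding strict_mono_Suc_iff by blast
  then show ?thesis by (intro exI[of _ ?l]) simp
qed

lemma strict_mono_enumeration:
  fixes L :: "nat set"
  assumes "finite L"
  obtains l :: "nat \<Rightarrow> nat" and h where "strict_mono l" "l ` {..<h} = L"
proof -
  let ?xs = "sorted_list_of_set L"
  have "?xs ! i < ?xs ! j" if "i < j" "j < length ?xs" for i j
    using that strict_sorted_list_of_set[of L] by (simp add: sorted_wrt_nth_less)
  then obtain l where l: "strict_mono l" "\<forall>i<length ?xs. l i = ?xs ! i"
    using strict_mono_extension[of "length ?xs" "(!) ?xs"] by blast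
  have "l ` {..<length ?xs} = (!) ?xs ` {..<length ?xs}" using l(2) by (intro image_cong) auto
  also have "\<dots> = set ?xs" by (auto simp: set_conv_nth)
  also have "\<dots> = L" using assms by simp
  finally show thesis using that l(1) by blast
qed

section \<open>Embeddings through a meet-closed set\<close>

definition witness :: "node set \<Rightarrow> nat \<Rightarrow> node \<Rightarrow> node \<Rightarrow> bool" where
  "witness M m y s \<longleftrightarrow> s \<in> M \<and> m \<le> length s \<and> prefix y s"

text \<open>The padding serves the branches above which \<open>M\<close> has no element of length at
  least m.\<close>

definition lift :: "node set \<Rightarrow> nat \<Rightarrow> node \<Rightarrow> node" where
  "lift M m y = (if Ex (witness M m y) then take m (Eps (witness M m y))
     else y @ replicate (m - length y) False)"

lemma witness_Eps: "Ex (witness M m y) \<Longrightarrow> m \<le> length (Eps (witness M m y)) \<and> prefix y (Eps (witness M m y))"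
  using someI_ex[of "witness M m y"] unfolding witness_def by blast

lemma length_lift: "length y \<le> m \<Longrightarrow> length (lift M m y) = m"
  using witness_Eps[of M m y] by (simp add: lift_def)

lemma prefix_lift: "length y \<le> m \<Longrightarrow> prefix y (lift M m y)"
  using witness_Eps[of M m y] by (cases "Ex (witness M m y)") (auto simp: lift_def prefix_def)

text \<open>The branch is stored in reversed order, so that primitive recursion extends it at its end.\<close>

primrec thread :: "node set \<Rightarrow> (nat \<Rightarrow> nat) \<Rightarrow> node \<Rightarrow> node" where
  "thread M l [] = take (l 0) (SOME s. s \<in> M)"
| "thread M l (b # x) = lift M (l (Suc (length x))) (thread M l x @ [b])"

text \<open>Two elements of M above a node of length l j + 1 have their meet in M, hence on a listed
  level after l j, so they agree up to l (j + 1). The witness chosen by \<open>lift\<close> is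
  therefore immaterial, and no element of M is missed.\<close>

lemma emb_through:
  assumes M: "M \<noteq> {}" "\<And>s t. s \<in> M \<Longrightarrow> t \<in> M \<Longrightarrow> meet s t \<in> M"
    and l: "strict_mono l" "length ` M \<subseteq> range l"
  shows "\<exists>\<psi>. emb \<psi> \<and> (\<forall>x. length (\<psi> x) = l (length x)) \<and>
    (\<forall>s\<in>M. \<forall>j. length s = l j \<longrightarrow> \<psi> (map (\<lambda>i. s ! l i) [0..<j]) = s)"
proof -
  have l0: "l 0 \<le> length s" if "s \<in> M" for s
  proof -
    have "length s \<in> range l" using l(2) that by blast
    then obtain j where "length s = l j" by (rule rangeE)
    then show ?thesis using strict_mono_less_eq[OF l(1), of 0 j] by simp
  qed
  have l_Suc: "Suc (l j) \<le> l (Suc j)" for j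
    using strict_monoD[OF l(1), of j "Suc j"] by simp
  have len: "length (thread M l x) = l (length x)" for x
  proof (induction x)
    case Nil
    have "(SOME s. s \<in> M) \<in> M" using M(1) by (simp add: some_in_eq)
    then show ?case using l0 by simp
  next
    case (Cons b x)
    then show ?case using l_Suc[of "length x"] by (simp add: length_lift)
  qed
  have pre: "prefix (thread M l x @ [b]) (thread M l (b # x))" for x b
    using l_Suc[of "length x"] by (simp add: prefix_lift len)
  define \<psi> where "\<psi> x = thread M l (rev x)" for x
  have "emb \<psi>" unfolding emb_def \<psi>_def using len pre[of "rev x" for x] by simp
  moreover have "length (\<psi> x) = l (length x)" for x by (simp add: \<psi>_def len)
  \<comment> \<open>Stated for initial segments of s, so that the induction can climb along s; the
    claim is the case where l j is the length of s.\<close>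
  moreover have through: "\<psi> (map (\<lambda>i. s ! l i) [0..<j]) = take (l j) s" if "s \<in> M" "l j \<le> length s" for s j
    using that
  proof (induction j)
    case 0
    let ?s = "SOME s. s \<in> M"
    have "?s \<in> M" using M(1) by (simp add: some_in_eq)
    then have "l 0 \<le> length (meet ?s s)" using M(2) 0(1) l0 by blast
    then show ?case by (simp add: \<psi>_def take_eq_of_meet)
  next
    case (Suc j)
    let ?x = "map (\<lambda>i. s ! l i) [0..<j]" and ?b = "s ! l j" and ?m = "l (Suc j)"
    have lj: "l j < length s" using Suc.prems(2) l_Suc[of j] by simp
    then have x: "\<psi> ?x = take (l j) s" using Suc by simp
    then have y: "\<psi> ?x @ [?b] = take (Suc (l j)) s" using lj by (simp add: take_Suc_conv_app_nth)
    let ?y = "take (Suc (l j)) s"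
    have ex: "witness M ?m ?y s" using Suc.prems by (auto simp: witness_def take_is_prefix)
    have "\<psi> (?x @ [?b]) = lift M ?m ?y"
      using y by (simp add: \<psi>_def)
    also have "\<dots> = take ?m (Eps (witness M ?m ?y))"
      using ex by (auto simp: lift_def)
    also have "\<dots> = take ?m s"
    proof (rule take_eq_of_meet)
      let ?t = "Eps (witness M ?m ?y)"
      have t: "witness M ?m ?y ?t" using ex by (rule someI)
      then have "meet ?t s \<in> M" using M(2) Suc.prems(1) by (simp add: witness_def)
      then have "length (meet ?t s) \<in> range l" using l(2) by blast
      then obtain i where i: "length (meet ?t s) = l i" by (rule rangeE)
      have "Suc (l j) \<le> length (meet ?t s)"
        using length_meet_ge[of ?y ?t s] t lj by (simp add: witness_def take_is_prefix)
      then have "j < i" using strict_mono_less[OF l(1), of j i] unfolding i by simp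
      then show "?m \<le> length (meet ?t s)"
        using strict_mono_less_eq[OF l(1), of "Suc j" i] unfolding i by simp
    qed
    finally show ?case by simp
  qed
  ultimately show ?thesis by (intro exI[of _ \<psi>]) simp
qed

text \<open>Only the bits at listed levels below s are kept; \<open>inv l (length s)\<close> counts
  these levels.\<close>

definition collapse :: "(nat \<Rightarrow> nat) \<Rightarrow> node \<Rightarrow> node" where
  "collapse l s = map (\<lambda>i. s ! l i) [0..<inv l (length s)]"

text \<open>An \<open>Em\<close> bijection maps levels to levels and keeps bits at lower levels, so
  s and its image collapse to the same node along their respective levels. An embedding through the
  meet closure of B thus sends the collapse of s to the image of s.\<close>

lemma Em_emb:
  assumes A: "A \<noteq> {}" and l: "strict_mono l" "l ` {..<h} = length ` meet_closure A"
    and Em: "Em n A B"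
  shows "\<exists>\<psi>. emb \<psi> \<and> (\<forall>x. length x < h \<longrightarrow> length (\<psi> x) mod n = l (length x) mod n) \<and>
    B = \<psi> ` collapse l ` A"
proof -
  let ?M = "meet_closure A" and ?N = "meet_closure B"
  obtain f where bij: "bij_betw f ?M ?N" and f: "\<And>s t. s \<in> ?M \<Longrightarrow> t \<in> ?M \<Longrightarrow>
        (prefix s t \<longleftrightarrow> prefix (f s) (f t)) \<and>
        (length s < length t \<longleftrightarrow> length (f s) < length (f t)) \<and>
        (s \<in> A \<longleftrightarrow> f s \<in> B) \<and>
        (length s < length t \<longrightarrow> t ! length s = f t ! length (f s)) \<and>
        color n (f s) = color n s"
    using Em unfolding Em_def by blast
  have eq: "length (f s) = length (f t)" if "s \<in> ?M" "t \<in> ?M" "length s = length t" for s t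
    using f[OF that(1,2)] f[OF that(2,1)] that(3) by simp
  have N: "f ` ?M = ?N" using bij by (simp add: bij_betw_def)
  \<comment> \<open>One representative per level; by \<open>eq\<close> the level of its image does
    not depend on the choice.\<close>
  define t where "t j = (SOME s. s \<in> ?M \<and> length s = l j)" for j
  have t: "t j \<in> ?M" "length (t j) = l j" if "j < h" for j
  proof -
    have "l j \<in> length ` ?M" using that l(2) by blast
    then have "\<exists>s. s \<in> ?M \<and> length s = l j" by auto
    then have "t j \<in> ?M \<and> length (t j) = l j" unfolding t_def by (rule someI_ex)
    then show "t j \<in> ?M" "length (t j) = l j" by simp_all
  qed
  have "length (f (t i)) < length (f (t j))" if "i < j" "j < h" for i j
    using f[OF t(1) t(1), of i j] t(2)[of i] t(2)[of j] that strict_monoD[OF l(1) that(1)] by simp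
  then obtain l' where l': "strict_mono l'" "\<And>i. i < h \<Longrightarrow> l' i = length (f (t i))"
    using strict_mono_extension[of h "\<lambda>j. length (f (t j))"] by blast
  have level: "\<exists>j<h. length s = l j \<and> length (f s) = l' j" if "s \<in> ?M" for s
  proof -
    have "length s \<in> l ` {..<h}" using that l(2) by blast
    then obtain j where j: "j < h" "length s = l j" by auto
    then show ?thesis using eq[OF that t(1)[OF j(1)]] t(2)[OF j(1)] l'(2)[OF j(1)] by auto
  qed
  have "length ` ?N \<subseteq> range l'"
  proof (rule image_subsetI)
    fix u assume "u \<in> ?N"
    then obtain s where "s \<in> ?M" "u = f s" using N by blast
    then show "length u \<in> range l'" using level[of s] by auto
  qed
  moreover have "?N \<noteq> {}" using N A subset_meet_closure[of A] by blast
  ultimately obtain \<psi> where \<psi>: "emb \<psi>" "\<And>x. length (\<psi> x) = l' (length x)"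
    and through: "\<And>s j. s \<in> ?N \<Longrightarrow> length s = l' j \<Longrightarrow> \<psi> (map (\<lambda>i. s ! l' i) [0..<j]) = s"
    using emb_through[of ?N l', OF _ meet_closure_closed l'(1)] by blast
  have \<psi>_collapse: "\<psi> (collapse l s) = f s" if s: "s \<in> ?M" for s
  proof -
    obtain j where j: "j < h" "length s = l j" "length (f s) = l' j" using level[OF s] by blast
    have "inv l (length s) = j" using inv_f_f[OF strict_mono_imp_inj_on[OF l(1)]] by (simp add: j(2))
    moreover have "s ! l i = f s ! l' i" if "i < j" for i
    proof -
      have "i < h" using that j(1) by simp
      moreover have "length (t i) < length s"
        using t(2)[OF \<open>i < h\<close>] j(2) strict_monoD[OF l(1) that] by simp
      ultimately show ?thesis using f[OF t(1)[OF \<open>i < h\<close>] s] t(2) l'(2) by simp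
    qed
    ultimately have "collapse l s = map (\<lambda>i. f s ! l' i) [0..<j]" by (simp add: collapse_def)
    then show ?thesis using through[of "f s" j] j(3) N s by auto
  qed
  have "B = f ` A"
  proof
    show "f ` A \<subseteq> B" using f subset_meet_closure[of A] by blast
    show "B \<subseteq> f ` A"
    proof
      fix u assume "u \<in> B"
      then obtain s where "s \<in> ?M" "u = f s" using N subset_meet_closure[of B] by blast
      then show "u \<in> f ` A" using f[of s s] \<open>u \<in> B\<close> by blast
    qed
  qed
  also have "\<dots> = \<psi> ` collapse l ` A"
    unfolding image_image using \<psi>_collapse subset_meet_closure[of A] by (intro image_cong) auto
  finally have "B = \<psi> ` collapse l ` A" .
  moreover have "length (\<psi> x) mod n = l (length x) mod n" if "length x < h" for x
    using f[OF t(1) t(1), OF that that] t(2)[OF that] l'(2)[OF that] \<psi>(2)[of x]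
    by (simp add: color_def Sigma_def)
  ultimately show ?thesis using \<psi>(1) by blast
qed

lemma meet_closure_emb_image:
  assumes "emb \<Phi>"
  shows "meet_closure (\<Phi> ` B) = \<Phi> ` meet_closure B"
  by (force simp: meet_closure_def emb_meet[OF assms, symmetric])

text \<open>Shows that a copy of A inside the range of \<open>\<Phi>\<close> comes from a copy of A
  in T: colored embeddings preserve and reflect each clause of \<open>Em\<close>.\<close>

lemma Em_pullback:
  assumes \<Phi>: "colored_emb n \<Phi>" and Em: "Em n A (\<Phi> ` B)"
  shows "Em n A B"
proof -
  let ?M = "meet_closure A" and ?N = "meet_closure B"
  note emb = colored_embD(1)[OF \<Phi>]
  obtain f where bij: "bij_betw f ?M (\<Phi> ` ?N)" and f: "\<And>s t. s \<in> ?M \<Longrightarrow> t \<in> ?M \<Longrightarrow>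
        (prefix s t \<longleftrightarrow> prefix (f s) (f t)) \<and>
        (length s < length t \<longleftrightarrow> length (f s) < length (f t)) \<and>
        (s \<in> A \<longleftrightarrow> f s \<in> \<Phi> ` B) \<and>
        (length s < length t \<longrightarrow> t ! length s = f t ! length (f s)) \<and>
        color n (f s) = color n s"
    using Em unfolding Em_def meet_closure_emb_image[OF emb] by blast
  define g where "g = inv \<Phi> \<circ> f"
  have "bij_betw (inv \<Phi>) (\<Phi> ` ?N) ?N"
    unfolding bij_betw_def using emb_inj[OF emb]
    by (auto simp: inj_on_def image_image)
  then have "bij_betw g ?M ?N" unfolding g_def using bij bij_betw_trans by blast
  moreover have fg: "f s = \<Phi> (g s)" if "s \<in> ?M" for s
  proof -
    have "f s \<in> range \<Phi>" using bij that unfolding bij_betw_def by blast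
    then show ?thesis by (simp add: g_def f_inv_into_f)
  qed
  moreover have "(prefix s t \<longleftrightarrow> prefix (g s) (g t)) \<and>
      (length s < length t \<longleftrightarrow> length (g s) < length (g t)) \<and> (s \<in> A \<longleftrightarrow> g s \<in> B) \<and>
      (length s < length t \<longrightarrow> t ! length s = g t ! length (g s)) \<and> color n (g s) = color n s"
    if s: "s \<in> ?M" and t: "t \<in> ?M" for s t
    using f[OF s t] emb_length_less(2)[OF emb, of "g s" "g t"] colored_embD(2)[OF \<Phi>, of "g s"]
    unfolding fg[OF s] fg[OF t]
    by (simp add: emb_prefix_iff[OF emb] emb_length_less_iff[OF emb]
        inj_image_mem_iff[OF emb_inj[OF emb]] color_def Sigma_def)
  ultimately show ?thesis unfolding Em_def by blast
qed

theorem theorem7: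
  fixes n k :: nat and A :: "bool list set" and \<chi> :: "bool list set \<Rightarrow> nat"
  assumes "n > 0" and "finite A" and "k > 0"
    and "\<forall>B\<in>Em_class n A. \<chi> B < k"
  shows "\<exists>S\<in>strong_Sigma n. \<exists>c. \<forall>B\<in>Em_class n A. B \<subseteq> S \<longrightarrow> \<chi> B = c"
proof (cases "A = {}")
  case True
  \<comment> \<open>The empty set is its only copy. It is treated apart because
    \<open>emb_through\<close> starts from an element of the meet closure.\<close>
  have "B = {}" if "B \<in> Em_class n A" for B
    using that subset_meet_closure[of B]
    by (auto simp: Em_class_def Em_def True meet_closure_def bij_betw_def)
  moreover have "range id \<in> strong_Sigma n" by (rule emb_range_strong[OF emb_id]) simp
  ultimately show ?thesis by blast
next
  case False
  have "finite (meet_closure A)"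
    unfolding meet_closure_def using assms(2) by (intro finite_image_set2) auto
  then obtain l :: "nat \<Rightarrow> nat" and h where l: "strict_mono l" "l ` {..<h} = length ` meet_closure A"
    using strict_mono_enumeration[of "length ` meet_closure A"] by blast
  let ?A0 = "collapse l ` A"
  have short: "length x < h" if x: "x \<in> ?A0" for x
  proof -
    obtain s where s: "s \<in> A" "x = collapse l s" using x by (rule imageE)
    then have "length s \<in> l ` {..<h}" using l(2) subset_meet_closure[of A] by blast
    then obtain j where j: "j < h" "length s = l j" by auto
    then have "inv l (length s) = j" using inv_f_f[OF strict_mono_imp_inj_on[OF l(1)]] by simp
    then show ?thesis using j(1) s(2) by (simp add: collapse_def)
  qed
  \<comment> \<open>The cut at \<open>k\<close> makes the range finite, as nothing bounds
    \<open>\<chi>\<close> outside the class; on copies of A it changes nothing.\<close>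
  define c where "c \<psi> = min (\<chi> (\<psi> ` ?A0)) k" for \<psi> :: "node \<Rightarrow> node"
  have "finite (range c)"
    by (rule finite_subset[of _ "{..k}"]) (auto simp: c_def)
  moreover have "depends_upto h c"
    unfolding depends_upto_def
  proof (intro allI impI)
    fix \<phi> \<phi>' :: "node \<Rightarrow> node" assume "\<forall>x. length x < h \<longrightarrow> \<phi> x = \<phi>' x"
    then have "\<phi> ` ?A0 = \<phi>' ` ?A0" using short by (intro image_cong) auto
    then show "c \<phi> = c \<phi>'" by (simp add: c_def)
  qed
  ultimately obtain \<Phi> v where \<Phi>: "colored_emb n \<Phi>" and v: "\<And>\<psi>. emb \<psi> \<Longrightarrow>
      (\<And>x. length x < h \<Longrightarrow> length (\<psi> x) mod n = l (length x) mod n) \<Longrightarrow> c (\<Phi> \<circ> \<psi>) = v"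
    using milliken_emb[OF assms(1), of c h "\<lambda>j. l j mod n"] by blast
  have "\<chi> B = v" if B: "B \<in> Em_class n A" "B \<subseteq> range \<Phi>" for B
  proof -
    obtain B' where B': "B = \<Phi> ` B'" using B(2) subset_imageE by metis
    have "Em n A (\<Phi> ` B')" using B(1) unfolding B' Em_class_def by simp
    then have "Em n A B'" by (rule Em_pullback[OF \<Phi>])
    then obtain \<psi> where \<psi>: "emb \<psi>" "\<And>x. length x < h \<Longrightarrow> length (\<psi> x) mod n = l (length x) mod n"
      "B' = \<psi> ` ?A0"
      using Em_emb[OF False l] by blast
    have "c (\<Phi> \<circ> \<psi>) = min (\<chi> B) k" by (simp only: c_def image_comp[symmetric] B' \<psi>(3))
    moreover have "\<chi> B < k" using assms(4) B(1) by blast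
    ultimately show ?thesis using v[OF \<psi>(1,2)] by simp
  qed
  moreover have "range \<Phi> \<in> strong_Sigma n"
    by (rule emb_range_strong[OF colored_embD(1)[OF \<Phi>] colored_embD(2)[OF \<Phi>]])
  ultimately show ?thesis by blast
qed

end
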